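(* Let $\mathcal{A}$ be an essentially small abelian length category, let $[\mathcal{U},\mathcal{T}]$ be a wide interval in $\mathsf{tors}\,\mathcal{A}$, and set $\mathcal{W}:=\mathcal{U}^\perp\cap\mathcal{T}$. (1) There are mutually inverse isomorphisms of complete lattices $\Phi\colon[\mathcal{U},\mathcal{T}]\to\mathsf{tors}\,\mathcal{W}$ and $\Psi\colon\mathsf{tors}\,\mathcal{W}\to[\mathcal{U},\mathcal{T}]$ given by $\Phi(\mathcal{V}):=\mathcal{U}^\perp\cap\mathcal{V}$ for $\mathcal{V}\in[\mathcal{U},\mathcal{T}]$ and $\Psi(\mathcal{X}):=\mathsf{T}(\mathcal{U}\cup\mathcal{X})$ for $\mathcal{X}\in\mathsf{tors}\,\mathcal{W}$. Moreover, $\Psi(\mathcal{X})=\mathcal{U}*\mathcal{X}$ for every $\mathcal{X}\in\mathsf{tors}\,\mathcal{W}$. (2) The isomorphism $\Phi$ preserves the brick labeling: the brick label of an arrow $\mathcal{V}_1\to\mathcal{V}_2$ in the Hasse quiver of $[\mathcal{U},\mathcal{T}]$ is the same as the brick label of the arrow $\Phi(\mathcal{V}_1)\to\Phi(\mathcal{V}_2)$ in the Hasse quiver of $\mathsf{tors}\,\mathcal{W}$. (3) The following three sets coincide: the set $\mathsf{sim}\,\mathcal{W}$ of isomorphism classes of simple objects of the abelian category $\mathcal{W}$; the set of brick labels of arrows in the Hasse quiver of $[\mathcal{U},\mathcal{T}]$ starting at $\mathcal{T}$; the set of brick labels of arrows in the Hasse quiver of $[\mathcal{U},\mathcal{T}]$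 ending at $\mathcal{U}$.
   Context: All subcategories are full and closed under isomorphism. An abelian length category is an abelian category in which every object has a finite composition series. For a subcategory $\mathcal{X}\subseteq\mathcal{A}$: $\mathcal{X}^\perp=\{Y\in\mathcal{A}\mid \mathrm{Hom}_{\mathcal{A}}(X,Y)=0 \text{ for all } X\in\mathcal{X}\}$. A torsion class in an abelian length category is a subcategory closed under extensions and factor objects; $\mathsf{tors}\,\mathcal{A}$ is the set of torsion classes in $\mathcal{A}$, ordered by inclusion (a complete lattice). $\mathsf{T}(\mathcal{X})$ is the smallest torsion class of $\mathcal{A}$ containing $\mathcal{X}$. $\mathcal{C}*\mathcal{C}'$ is the subcategory of objects $X$ admitting a short exact sequence $0\to C\to X\to C'\to0$ with $C\in\mathcal{C}$, $C'\in\mathcal{C}'$. For $\mathcal{U}\subseteq\mathcal{T}$ in $\mathsf{tors}\,\mathcal{A}$, $[\mathcal{U},\mathcal{T}]=\{\mathcal{V}\in\mathsf{tors}\,\mathcal{A}\mid\mathcal{U}\subseteq\mathcal{V}\subseteq\mathcal{T}\}$. A wide subcategory is one closed under kernels, cokernels and extensions in $\mathcal{A}$; it is itself an (essentially small) abelian length category, so $\mathsf{tors}\,\mathcal{W}$ and its brick labeling are defined. The interval $[\mathcal{U},\mathcal{T}]$ is a wide interval if $\mathcal{U}^\perp\cap\mathcal{T}$ is a wide subcategory of $\mathcal{A}$. The Hasse quiver of a partially ordered set has its elements as vertices and an arrow $x\to y$ iff $y<x$ and there is no $z$ with $y<z<x$. A brick is an object whose endomorphism ring is a division ring. It is known that there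 is an arrow $\mathcal{T}\to\mathcal{U}$ in the Hasse quiver of $\mathsf{tors}\,\mathcal{A}$ (for $\mathcal{U}\subseteq\mathcal{T}$) if and only if $\mathcal{U}^\perp\cap\mathcal{T}$ contains exactly one brick up to isomorphism; the isomorphism class of this brick is the brick label of the arrow. *)

theory Defs
  imports "HOL-Algebra.Complete_Lattice" "HOL-Algebra.Ring"
begin

section \<open>Abelian length categories\<close>

text \<open>
  A category has a set of objects and a set of arrows drawn from two HOL types.  Every such category
  is small, which is how essential smallness is rendered.  The abelian group structure on the
  morphism sets is part of the data.
\<close>

record ('o, 'm) additive_cat =
  Obj :: "'o set"
  Arr :: "'m set"
  Dom :: "'m \<Rightarrow> 'o"
  Cod :: "'m \<Rightarrow> 'o"
  Comp :: "'m \<Rightarrow> 'm \<Rightarrow> 'm" (infixl \<open>\<cdot>\<index>\<close> 70)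
  Ident :: "'o \<Rightarrow> 'm"
  AddArr :: "'m \<Rightarrow> 'm \<Rightarrow> 'm"
  ZeroArr :: "'o \<Rightarrow> 'o \<Rightarrow> 'm"

definition Hom :: "('o, 'm, 'z) additive_cat_scheme \<Rightarrow> 'o \<Rightarrow> 'o \<Rightarrow> 'm set" where
  "Hom C X Y = {f \<in> Arr C. Dom C f = X \<and> Cod C f = Y}"

definition Hom_group :: "('o, 'm, 'z) additive_cat_scheme \<Rightarrow> 'o \<Rightarrow> 'o \<Rightarrow> 'm monoid" where
  "Hom_group C X Y = \<lparr>carrier = Hom C X Y, mult = AddArr C, one = ZeroArr C X Y\<rparr>"

definition End_ring :: "('o, 'm, 'z) additive_cat_scheme \<Rightarrow> 'o \<Rightarrow> 'm ring" where
  "End_ring C X = \<lparr>carrier = Hom C X X, mult = Comp C, one = Ident C X,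
                   zero = ZeroArr C X X, add = AddArr C\<rparr>"

definition monic :: "('o, 'm, 'z) additive_cat_scheme \<Rightarrow> 'm \<Rightarrow> bool" where
  "monic C f \<longleftrightarrow> f \<in> Arr C \<and>
     (\<forall>X \<in> Obj C. \<forall>g \<in> Hom C X (Dom C f). \<forall>h \<in> Hom C X (Dom C f).
        f \<cdot>\<^bsub>C\<^esub> g = f \<cdot>\<^bsub>C\<^esub> h \<longrightarrow> g = h)"

definition epic :: "('o, 'm, 'z) additive_cat_scheme \<Rightarrow> 'm \<Rightarrow> bool" where
  "epic C f \<longleftrightarrow> f \<in> Arr C \<and>
     (\<forall>Y \<in> Obj C. \<forall>g \<in> Hom C (Cod C f) Y. \<forall>h \<in> Hom C (Cod C f) Y.
        g \<cdot>\<^bsub>C\<^esub> f = h \<cdot>\<^bsub>C\<^esub> f \<longrightarrow> g = h)"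

definition iso_arrow :: "('o, 'm, 'z) additive_cat_scheme \<Rightarrow> 'm \<Rightarrow> bool" where
  "iso_arrow C f \<longleftrightarrow> f \<in> Arr C \<and>
     (\<exists>g \<in> Hom C (Cod C f) (Dom C f).
        g \<cdot>\<^bsub>C\<^esub> f = Ident C (Dom C f) \<and> f \<cdot>\<^bsub>C\<^esub> g = Ident C (Cod C f))"

definition isomorphic :: "('o, 'm, 'z) additive_cat_scheme \<Rightarrow> 'o \<Rightarrow> 'o \<Rightarrow> bool" where
  "isomorphic C X Y \<longleftrightarrow> (\<exists>f \<in> Hom C X Y. iso_arrow C f)"

definition iso_class :: "('o, 'm, 'z) additive_cat_scheme \<Rightarrow> 'o \<Rightarrow> 'o set" where
  "iso_class C X = {Y \<in> Obj C. isomorphic C X Y}"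

definition zero_object :: "('o, 'm, 'z) additive_cat_scheme \<Rightarrow> 'o \<Rightarrow> bool" where
  "zero_object C Z \<longleftrightarrow> Z \<in> Obj C \<and>
     (\<forall>X \<in> Obj C. (\<exists>!f. f \<in> Hom C Z X) \<and> (\<exists>!f. f \<in> Hom C X Z))"

definition is_product :: "('o, 'm, 'z) additive_cat_scheme \<Rightarrow> 'm \<Rightarrow> 'm \<Rightarrow> 'o \<Rightarrow> 'o \<Rightarrow> bool" where
  "is_product C p q X Y \<longleftrightarrow> (\<exists>P \<in> Obj C. p \<in> Hom C P X \<and> q \<in> Hom C P Y \<and>
     (\<forall>Z \<in> Obj C. \<forall>f \<in> Hom C Z X. \<forall>g \<in> Hom C Z Y.
        \<exists>!u. u \<in> Hom C Z P \<and> p \<cdot>\<^bsub>C\<^esub> u = f \<and> q \<cdot>\<^bsub>C\<^esub> u = g))"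

definition is_kernel :: "('o, 'm, 'z) additive_cat_scheme \<Rightarrow> 'm \<Rightarrow> 'm \<Rightarrow> bool" where
  "is_kernel C k f \<longleftrightarrow> k \<in> Arr C \<and> f \<in> Arr C \<and> Cod C k = Dom C f \<and>
     f \<cdot>\<^bsub>C\<^esub> k = ZeroArr C (Dom C k) (Cod C f) \<and>
     (\<forall>X \<in> Obj C. \<forall>g \<in> Hom C X (Dom C f). f \<cdot>\<^bsub>C\<^esub> g = ZeroArr C X (Cod C f) \<longrightarrow>
        (\<exists>!u. u \<in> Hom C X (Dom C k) \<and> k \<cdot>\<^bsub>C\<^esub> u = g))"

definition is_cokernel :: "('o, 'm, 'z) additive_cat_scheme \<Rightarrow> 'm \<Rightarrow> 'm \<Rightarrow> bool" where
  "is_cokernel C c f \<longleftrightarrow> c \<in> Arr C \<and> f \<in> Arr C \<and> Dom C c = Cod C f \<and>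
     c \<cdot>\<^bsub>C\<^esub> f = ZeroArr C (Dom C f) (Cod C c) \<and>
     (\<forall>Y \<in> Obj C. \<forall>g \<in> Hom C (Cod C f) Y. g \<cdot>\<^bsub>C\<^esub> f = ZeroArr C (Dom C f) Y \<longrightarrow>
        (\<exists>!u. u \<in> Hom C (Cod C c) Y \<and> u \<cdot>\<^bsub>C\<^esub> c = g))"

text \<open>The pair \<open>f, g\<close> is a short exact sequence \<open>0 \<rightarrow> Dom f \<rightarrow> Cod f \<rightarrow> Cod g \<rightarrow> 0\<close>.\<close>

definition short_exact :: "('o, 'm, 'z) additive_cat_scheme \<Rightarrow> 'm \<Rightarrow> 'm \<Rightarrow> bool" where
  "short_exact C f g \<longleftrightarrow> is_kernel C f g \<and> is_cokernel C g f"

definition simple_object :: "('o, 'm, 'z) additive_cat_scheme \<Rightarrow> 'o \<Rightarrow> bool" where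
  "simple_object C S \<longleftrightarrow> S \<in> Obj C \<and> \<not> zero_object C S \<and>
     (\<forall>f. monic C f \<and> Cod C f = S \<longrightarrow> zero_object C (Dom C f) \<or> iso_arrow C f)"

text \<open>A chain \<open>0 = X\<^sub>0 \<subseteq> X\<^sub>1 \<subseteq> \<dots> \<subseteq> X\<^sub>n = X\<close> of subobjects with simple subquotients.\<close>

definition has_composition_series :: "('o, 'm, 'z) additive_cat_scheme \<Rightarrow> 'o \<Rightarrow> bool" where
  "has_composition_series C X \<longleftrightarrow> (\<exists>(n::nat) F. zero_object C (F 0) \<and> F n = X \<and>
     (\<forall>i<n. \<exists>f g. short_exact C f g \<and> Dom C f = F i \<and> Cod C f = F (Suc i) \<and>
        simple_object C (Cod C g)))"

locale category =
  fixes C :: "('o, 'm, 'z) additive_cat_scheme" (structure)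
  assumes Dom_Obj: "f \<in> Arr C \<Longrightarrow> Dom C f \<in> Obj C"
    and Cod_Obj: "f \<in> Arr C \<Longrightarrow> Cod C f \<in> Obj C"
    and Ident_Hom: "X \<in> Obj C \<Longrightarrow> Ident C X \<in> Hom C X X"
    and Comp_Hom: "\<lbrakk>f \<in> Hom C X Y; g \<in> Hom C Y Z\<rbrakk> \<Longrightarrow> g \<cdot> f \<in> Hom C X Z"
    and Comp_assoc: "\<lbrakk>f \<in> Hom C W X; g \<in> Hom C X Y; h \<in> Hom C Y Z\<rbrakk> \<Longrightarrow> h \<cdot> (g \<cdot> f) = h \<cdot> g \<cdot> f"
    and Comp_Ident_right: "f \<in> Hom C X Y \<Longrightarrow> f \<cdot> Ident C X = f"
    and Comp_Ident_left: "f \<in> Hom C X Y \<Longrightarrow> Ident C Y \<cdot> f = f"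

locale preadditive_category = category C
  for C :: "('o, 'm, 'z) additive_cat_scheme" (structure) +
  assumes Hom_comm_group: "\<lbrakk>X \<in> Obj C; Y \<in> Obj C\<rbrakk> \<Longrightarrow> comm_group (Hom_group C X Y)"
    and Comp_add_left: "\<lbrakk>f \<in> Hom C X Y; g \<in> Hom C Y Z; h \<in> Hom C Y Z\<rbrakk>
      \<Longrightarrow> AddArr C g h \<cdot> f = AddArr C (g \<cdot> f) (h \<cdot> f)"
    and Comp_add_right: "\<lbrakk>f \<in> Hom C X Y; g \<in> Hom C X Y; h \<in> Hom C Y Z\<rbrakk>
      \<Longrightarrow> h \<cdot> AddArr C f g = AddArr C (h \<cdot> f) (h \<cdot> g)"

locale abelian_category = preadditive_category C
  for C :: "('o, 'm, 'z) additive_cat_scheme" (structure) +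
  assumes zero_object_ex: "\<exists>Z. zero_object C Z"
    and product_ex: "\<lbrakk>X \<in> Obj C; Y \<in> Obj C\<rbrakk> \<Longrightarrow> \<exists>p q. is_product C p q X Y"
    and kernel_ex: "f \<in> Arr C \<Longrightarrow> \<exists>k. is_kernel C k f"
    and cokernel_ex: "f \<in> Arr C \<Longrightarrow> \<exists>c. is_cokernel C c f"
    and monic_is_kernel: "monic C f \<Longrightarrow> \<exists>g. is_kernel C f g"
    and epic_is_cokernel: "epic C f \<Longrightarrow> \<exists>g. is_cokernel C f g"

locale abelian_length_category = abelian_category C
  for C :: "('o, 'm, 'z) additive_cat_scheme" (structure) +
  assumes finite_length: "X \<in> Obj C \<Longrightarrow> has_composition_series C X"


section \<open>Subcategories\<close>

text \<open>Full subcategories closed under isomorphism are represented by their sets of objects.\<close>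

definition subcategory :: "('o, 'm, 'z) additive_cat_scheme \<Rightarrow> 'o set \<Rightarrow> bool" where
  "subcategory C S \<longleftrightarrow> S \<subseteq> Obj C \<and> (\<forall>X \<in> S. \<forall>Y \<in> Obj C. isomorphic C X Y \<longrightarrow> Y \<in> S)"

definition full_on :: "('o, 'm, 'z) additive_cat_scheme \<Rightarrow> 'o set \<Rightarrow> ('o, 'm, 'z) additive_cat_scheme"
  where "full_on C S = C\<lparr>Obj := S, Arr := {f \<in> Arr C. Dom C f \<in> S \<and> Cod C f \<in> S}\<rparr>"

definition right_perp :: "('o, 'm, 'z) additive_cat_scheme \<Rightarrow> 'o set \<Rightarrow> 'o set" where
  "right_perp C S = {Y \<in> Obj C. \<forall>X \<in> S. Hom C X Y = {ZeroArr C X Y}}"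

definition ext_product :: "('o, 'm, 'z) additive_cat_scheme \<Rightarrow> 'o set \<Rightarrow> 'o set \<Rightarrow> 'o set" where
  "ext_product C S S' =
     {X \<in> Obj C. \<exists>f g. short_exact C f g \<and> Dom C f \<in> S \<and> Cod C f = X \<and> Cod C g \<in> S'}"

definition closed_extensions :: "('o, 'm, 'z) additive_cat_scheme \<Rightarrow> 'o set \<Rightarrow> bool" where
  "closed_extensions C S \<longleftrightarrow>
     (\<forall>f g. short_exact C f g \<and> Dom C f \<in> S \<and> Cod C g \<in> S \<longrightarrow> Cod C f \<in> S)"

definition closed_factors :: "('o, 'm, 'z) additive_cat_scheme \<Rightarrow> 'o set \<Rightarrow> bool" where
  "closed_factors C S \<longleftrightarrow> (\<forall>f. epic C f \<and> Dom C f \<in> S \<longrightarrow> Cod C f \<in> S)"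

definition closed_kernels :: "('o, 'm, 'z) additive_cat_scheme \<Rightarrow> 'o set \<Rightarrow> bool" where
  "closed_kernels C S \<longleftrightarrow>
     (\<forall>f k. is_kernel C k f \<and> Dom C f \<in> S \<and> Cod C f \<in> S \<longrightarrow> Dom C k \<in> S)"

definition closed_cokernels :: "('o, 'm, 'z) additive_cat_scheme \<Rightarrow> 'o set \<Rightarrow> bool" where
  "closed_cokernels C S \<longleftrightarrow>
     (\<forall>f c. is_cokernel C c f \<and> Dom C f \<in> S \<and> Cod C f \<in> S \<longrightarrow> Cod C c \<in> S)"

text \<open>As usual, wide subcategories and torsion classes are nonempty, hence contain the zero objects.\<close>

definition wide_subcategory :: "('o, 'm, 'z) additive_cat_scheme \<Rightarrow> 'o set \<Rightarrow> bool" where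
  "wide_subcategory C S \<longleftrightarrow> subcategory C S \<and> S \<noteq> {} \<and>
     closed_kernels C S \<and> closed_cokernels C S \<and> closed_extensions C S"

definition torsion_class :: "('o, 'm, 'z) additive_cat_scheme \<Rightarrow> 'o set \<Rightarrow> bool" where
  "torsion_class C S \<longleftrightarrow> subcategory C S \<and> S \<noteq> {} \<and> closed_extensions C S \<and> closed_factors C S"

definition tors :: "('o, 'm, 'z) additive_cat_scheme \<Rightarrow> 'o set set" where
  "tors C = {S. torsion_class C S}"

definition gen_tors :: "('o, 'm, 'z) additive_cat_scheme \<Rightarrow> 'o set \<Rightarrow> 'o set" where
  "gen_tors C S = (LEAST T. T \<in> tors C \<and> S \<subseteq> T)"

definition tors_interval :: "('o, 'm, 'z) additive_cat_scheme \<Rightarrow> 'o set \<Rightarrow> 'o set \<Rightarrow> 'o set set" where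
  "tors_interval C U T = {V \<in> tors C. U \<subseteq> V \<and> V \<subseteq> T}"

definition wide_interval :: "('o, 'm, 'z) additive_cat_scheme \<Rightarrow> 'o set \<Rightarrow> 'o set \<Rightarrow> bool" where
  "wide_interval C U T \<longleftrightarrow> U \<in> tors C \<and> T \<in> tors C \<and> U \<subseteq> T \<and>
     wide_subcategory C (right_perp C U \<inter> T)"


section \<open>Lattices, Hasse quivers and brick labels\<close>

definition inclusion_order :: "'a set set \<Rightarrow> 'a set gorder" where
  "inclusion_order P = \<lparr>carrier = P, eq = (=), le = (\<subseteq>)\<rparr>"

definition complete_lattice_iso ::
    "('a, 'c) gorder_scheme \<Rightarrow> ('b, 'd) gorder_scheme \<Rightarrow> ('a \<Rightarrow> 'b) \<Rightarrow> bool" where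
  "complete_lattice_iso L M f \<longleftrightarrow>
     bij_betw f (carrier L) (carrier M) \<and> sup_pres L M f \<and> inf_pres L M f"

text \<open>An arrow \<open>x \<rightarrow> y\<close> of the Hasse quiver points from the larger to the smaller element.\<close>

definition hasse_arrow :: "'a::order set \<Rightarrow> 'a \<Rightarrow> 'a \<Rightarrow> bool" where
  "hasse_arrow P x y \<longleftrightarrow> x \<in> P \<and> y \<in> P \<and> y < x \<and> \<not> (\<exists>z \<in> P. y < z \<and> z < x)"

definition division_ring :: "('a, 'b) ring_scheme \<Rightarrow> bool" where
  "division_ring R \<longleftrightarrow> ring R \<and> \<one>\<^bsub>R\<^esub> \<noteq> \<zero>\<^bsub>R\<^esub> \<and> Units R = carrier R - {\<zero>\<^bsub>R\<^esub>}"

definition brick :: "('o, 'm, 'z) additive_cat_scheme \<Rightarrow> 'o \<Rightarrow> bool" where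
  "brick C B \<longleftrightarrow> B \<in> Obj C \<and> division_ring (End_ring C B)"

text \<open>
  \<open>L\<close> is the label of the arrow \<open>T \<rightarrow> U\<close> of the Hasse quiver of \<open>tors C\<close>: it is the only
  isomorphism class of bricks in \<open>U\<^sup>\<bottom> \<inter> T\<close>.  In particular an arrow has at most one label.
\<close>

definition brick_label :: "('o, 'm, 'z) additive_cat_scheme \<Rightarrow> 'o set \<Rightarrow> 'o set \<Rightarrow> 'o set \<Rightarrow> bool" where
  "brick_label C T U L \<longleftrightarrow> hasse_arrow (tors C) T U \<and>
     iso_class C ` {B \<in> right_perp C U \<inter> T. brick C B} = {L}"

definition sim :: "('o, 'm, 'z) additive_cat_scheme \<Rightarrow> 'o set set" where
  "sim C = iso_class C ` {S. simple_object C S}"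

end

theory Submission
  imports Defs
begin

text \<open>
  Torsion classes are handled through quotients.  For a torsion class \<open>X\<close> of \<open>W = U\<^sup>\<bottom> \<inter> T\<close>, the objects
  of \<open>T\<close> all of whose quotients in \<open>U\<^sup>\<bottom>\<close> lie in \<open>X\<close> form a torsion class; by the torsion sequence of
  \<open>U\<close> it equals \<open>U * X\<close>, and wideness of \<open>W\<close> is what makes it closed under extensions.  This gives the
  inverse of \<open>V \<mapsto> U\<^sup>\<bottom> \<inter> V\<close>.  Labels are preserved because \<open>V\<^sub>2\<^sup>\<bottom> \<inter> V\<^sub>1\<close> is the same class whether computed in the
  whole category or in \<open>W\<close>.  It then remains to treat the full lattice of torsion classes of \<open>W\<close>: a
  maximal proper torsion class consists of the objects without nonzero arrows to a simple \<open>S\<close>, a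
  minimal nonzero one is generated by a simple \<open>S\<close>, and the label is \<open>S\<close> in both cases.
\<close>

section \<open>Preadditive exact categories\<close>

text \<open>Torsion sequences, labels and the two ends of the lattice are studied both in the
  ambient category and inside \<open>W\<close>. They are therefore proved once, for a kind of
  category that is inherited by wide subcategories. Finite length resists this: a simple object of
  \<open>W\<close> need not be simple outside, so composition series do not restrict. A numerical
  size, computed outside and reused inside, does restrict, and objects of minimal size replace most
  inductions on length.

  Wideness enters closure under extensions as follows. Let \<open>Q\<close> in
  \<open>right_perp C U\<close> be a quotient of an extension of \<open>N\<close> by
  \<open>L\<close>. The image of \<open>L\<close> in \<open>Q\<close> is a subobject, hence lies in
  \<open>right_perp C U\<close>, but the remaining quotient \<open>R\<close> of \<open>N\<close>
  could in general have torsion, and then the condition on the quotients of \<open>N\<close> would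
  say nothing about \<open>R\<close>. Since \<open>R\<close> is the cokernel of an arrow of
  \<open>W\<close>, wideness puts it back into \<open>right_perp C U\<close>.\<close>

lemma HomI: "f \<in> Arr C \<Longrightarrow> f \<in> Hom C (Dom C f) (Cod C f)"
  by (simp add: Hom_def)

lemma HomD:
  assumes "f \<in> Hom C X Y"
  shows "f \<in> Arr C" "Dom C f = X" "Cod C f = Y"
  using assms by (auto simp: Hom_def)

section \<open>Isomorphisms, monics and epics under composition\<close>

context category
begin

lemma Hom_Obj:
  assumes "f \<in> Hom C X Y"
  shows "X \<in> Obj C" "Y \<in> Obj C"
  using assms Dom_Obj Cod_Obj by (auto simp: Hom_def)

lemma iso_arrowE:
  assumes "iso_arrow C f" "f \<in> Hom C X Y"
  obtains g where "g \<in> Hom C Y X" "g \<cdot> f = Ident C X" "f \<cdot> g = Ident C Y"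
  using assms by (auto simp: iso_arrow_def Hom_def)

lemma iso_arrowI:
  assumes "f \<in> Hom C X Y" "g \<in> Hom C Y X" "g \<cdot> f = Ident C X" "f \<cdot> g = Ident C Y"
  shows "iso_arrow C f"
  using assms by (auto simp: iso_arrow_def Hom_def)

lemma iso_arrow_Ident: "X \<in> Obj C \<Longrightarrow> iso_arrow C (Ident C X)"
  using Comp_Ident_left Ident_Hom iso_arrowI by blast

lemma isomorphicI: "f \<in> Hom C X Y \<Longrightarrow> iso_arrow C f \<Longrightarrow> isomorphic C X Y"
  by (auto simp: isomorphic_def)

lemma isomorphic_sym: "isomorphic C X Y \<Longrightarrow> isomorphic C Y X"
  unfolding isomorphic_def by (meson iso_arrowE iso_arrowI)

lemma iso_arrow_comp:
  assumes "f \<in> Hom C X Y" "g \<in> Hom C Y Z" "iso_arrow C f" "iso_arrow C g"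
  shows "iso_arrow C (g \<cdot> f)"
proof -
  obtain f' where f': "f' \<in> Hom C Y X" "f' \<cdot> f = Ident C X" "f \<cdot> f' = Ident C Y"
    using iso_arrowE[OF assms(3,1)] by blast
  obtain g' where g': "g' \<in> Hom C Z Y" "g' \<cdot> g = Ident C Y" "g \<cdot> g' = Ident C Z"
    using iso_arrowE[OF assms(4,2)] by blast
  have gf: "g \<cdot> f \<in> Hom C X Z" and fg: "f' \<cdot> g' \<in> Hom C Z X"
    using Comp_Hom assms(1,2) f'(1) g'(1) by auto
  have "g' \<cdot> (g \<cdot> f) = f"
    using Comp_assoc[OF assms(1,2) g'(1)] g'(2) Comp_Ident_left[OF assms(1)] by simp
  then have 1: "(f' \<cdot> g') \<cdot> (g \<cdot> f) = Ident C X"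
    using Comp_assoc[OF gf g'(1) f'(1)] f'(2) by simp
  have "f \<cdot> (f' \<cdot> g') = g'"
    using Comp_assoc[OF g'(1) f'(1) assms(1)] f'(3) Comp_Ident_left[OF g'(1)] by simp
  then have 2: "(g \<cdot> f) \<cdot> (f' \<cdot> g') = Ident C Z"
    using Comp_assoc[OF fg assms(1,2)] g'(3) by simp
  show ?thesis
    using iso_arrowI[OF gf fg 1 2] .
qed

lemma isomorphic_trans: "isomorphic C X Y \<Longrightarrow> isomorphic C Y Z \<Longrightarrow> isomorphic C X Z"
  unfolding isomorphic_def by (meson Comp_Hom iso_arrow_comp)

lemma iso_class_eq: "isomorphic C X Y \<Longrightarrow> iso_class C X = iso_class C Y"
  unfolding iso_class_def using isomorphic_sym isomorphic_trans by blast

lemma monic_cancel: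
  "\<lbrakk>monic C f; f \<in> Hom C Y Z; g \<in> Hom C X Y; h \<in> Hom C X Y; f \<cdot> g = f \<cdot> h\<rbrakk> \<Longrightarrow> g = h"
  unfolding monic_def using HomD Hom_Obj by metis

lemma epic_cancel:
  "\<lbrakk>epic C f; f \<in> Hom C X Y; g \<in> Hom C Y Z; h \<in> Hom C Y Z; g \<cdot> f = h \<cdot> f\<rbrakk> \<Longrightarrow> g = h"
  unfolding epic_def using HomD Hom_Obj by metis

lemma iso_arrow_monic:
  assumes "iso_arrow C f"
  shows "monic C f"
  unfolding monic_def
proof (intro conjI ballI impI)
  show "f \<in> Arr C" using assms by (simp add: iso_arrow_def)
  then have f: "f \<in> Hom C (Dom C f) (Cod C f)" by (rule HomI)
  fix X g h assume "g \<in> Hom C X (Dom C f)" "h \<in> Hom C X (Dom C f)" "f \<cdot> g = f \<cdot> h"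
  then show "g = h"
    using iso_arrowE[OF assms f] Comp_assoc[OF _ f] Comp_Ident_left by metis
qed

lemma iso_arrow_epic:
  assumes "iso_arrow C f"
  shows "epic C f"
  unfolding epic_def
proof (intro conjI ballI impI)
  show "f \<in> Arr C" using assms by (simp add: iso_arrow_def)
  then have f: "f \<in> Hom C (Dom C f) (Cod C f)" by (rule HomI)
  fix Y g h assume "g \<in> Hom C (Cod C f) Y" "h \<in> Hom C (Cod C f) Y" "g \<cdot> f = h \<cdot> f"
  then show "g = h"
    using iso_arrowE[OF assms f] Comp_assoc[OF _ f] Comp_Ident_right by metis
qed

lemma monic_comp:
  assumes "monic C f" "monic C g" "f \<in> Hom C X Y" "g \<in> Hom C Y Z"
  shows "monic C (g \<cdot> f)"
proof -
  have gf: "g \<cdot> f \<in> Hom C X Z" using assms Comp_Hom by blast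
  have "a = b" if "a \<in> Hom C W X" "b \<in> Hom C W X" "(g \<cdot> f) \<cdot> a = (g \<cdot> f) \<cdot> b" for W a b
  proof -
    have "g \<cdot> (f \<cdot> a) = g \<cdot> (f \<cdot> b)" using that assms Comp_assoc by metis
    then have "f \<cdot> a = f \<cdot> b" using that assms monic_cancel Comp_Hom by meson
    then show ?thesis using that assms monic_cancel by blast
  qed
  then show ?thesis using gf HomD[OF gf] unfolding monic_def by metis
qed

lemma epic_comp:
  assumes "epic C f" "epic C g" "f \<in> Hom C X Y" "g \<in> Hom C Y Z"
  shows "epic C (g \<cdot> f)"
proof -
  have gf: "g \<cdot> f \<in> Hom C X Z" using assms Comp_Hom by blast
  have "a = b" if "a \<in> Hom C Z W" "b \<in> Hom C Z W" "a \<cdot> (g \<cdot> f) = b \<cdot> (g \<cdot> f)" for W a b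
  proof -
    have "(a \<cdot> g) \<cdot> f = (b \<cdot> g) \<cdot> f" using that assms Comp_assoc by metis
    then have "a \<cdot> g = b \<cdot> g" using that assms epic_cancel Comp_Hom by meson
    then show ?thesis using that assms epic_cancel by blast
  qed
  then show ?thesis using gf HomD[OF gf] unfolding epic_def by metis
qed

lemma monic_right_factor:
  assumes "monic C (g \<cdot> f)" "f \<in> Hom C X Y" "g \<in> Hom C Y Z"
  shows "monic C f"
proof -
  have gf: "g \<cdot> f \<in> Hom C X Z" using assms Comp_Hom by blast
  have "a = b" if "a \<in> Hom C W X" "b \<in> Hom C W X" "f \<cdot> a = f \<cdot> b" for W a b
    using monic_cancel[OF assms(1) gf that(1,2)] Comp_assoc[OF that(1) assms(2,3)]
      Comp_assoc[OF that(2) assms(2,3)] that(3) by simp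
  then show ?thesis using assms(2) HomD[OF assms(2)] unfolding monic_def by metis
qed

lemma epic_left_factor:
  assumes "epic C (g \<cdot> f)" "f \<in> Hom C X Y" "g \<in> Hom C Y Z"
  shows "epic C g"
proof -
  have gf: "g \<cdot> f \<in> Hom C X Z" using assms Comp_Hom by blast
  have "a = b" if "a \<in> Hom C Z W" "b \<in> Hom C Z W" "a \<cdot> g = b \<cdot> g" for W a b
    using epic_cancel[OF assms(1) gf that(1,2)] Comp_assoc[OF assms(2,3) that(1)]
      Comp_assoc[OF assms(2,3) that(2)] that(3) by simp
  then show ?thesis using assms(3) HomD[OF assms(3)] unfolding epic_def by metis
qed

end

section \<open>Zero arrows, kernels and cokernels\<close>

context preadditive_category
begin

lemma zero_Hom:
  assumes "X \<in> Obj C" "Y \<in> Obj C"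
  shows "ZeroArr C X Y \<in> Hom C X Y"
proof -
  interpret comm_group "Hom_group C X Y" using Hom_comm_group assms .
  show ?thesis using one_closed by (simp add: Hom_group_def)
qed

lemma add_idem_zero:
  assumes "f \<in> Hom C X Y" "AddArr C f f = f"
  shows "f = ZeroArr C X Y"
proof -
  interpret comm_group "Hom_group C X Y" using Hom_comm_group assms Hom_Obj by blast
  show ?thesis using assms l_cancel_one'[of f f] by (simp add: Hom_group_def)
qed

lemma zero_add_zero:
  assumes "X \<in> Obj C" "Y \<in> Obj C"
  shows "AddArr C (ZeroArr C X Y) (ZeroArr C X Y) = ZeroArr C X Y"
proof -
  interpret comm_group "Hom_group C X Y" using Hom_comm_group assms .
  show ?thesis using l_one[OF one_closed] by (simp add: Hom_group_def)
qed

lemma comp_zero_right: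
  assumes "f \<in> Hom C X Y" "W \<in> Obj C"
  shows "f \<cdot> ZeroArr C W X = ZeroArr C W Y"
proof -
  have "f \<cdot> ZeroArr C W X \<in> Hom C W Y"
    using assms zero_Hom Hom_Obj Comp_Hom by blast
  then show ?thesis
    using assms Comp_add_right zero_add_zero zero_Hom Hom_Obj add_idem_zero by metis
qed

lemma comp_zero_left:
  assumes "f \<in> Hom C X Y" "Z \<in> Obj C"
  shows "ZeroArr C Y Z \<cdot> f = ZeroArr C X Z"
proof -
  have "ZeroArr C Y Z \<cdot> f \<in> Hom C X Z"
    using assms zero_Hom Hom_Obj Comp_Hom by blast
  then show ?thesis
    using assms Comp_add_left zero_add_zero zero_Hom Hom_Obj add_idem_zero by metis
qed

text \<open>Subtraction is not part of the data, so the difference of \<open>g\<close> and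
  \<open>h\<close> is extracted from the group of arrows. The last clause turns cancellation into
  annihilation, which is how \<open>monicI\<close> and \<open>epicI\<close> use it.\<close>

lemma diff_ex:
  assumes "g \<in> Hom C X Y" "h \<in> Hom C X Y"
  obtains d where "d \<in> Hom C X Y" "AddArr C d h = g" "d = ZeroArr C X Y \<Longrightarrow> g = h"
proof -
  interpret comm_group "Hom_group C X Y" using Hom_comm_group assms Hom_Obj by blast
  have gh: "g \<in> carrier (Hom_group C X Y)" "h \<in> carrier (Hom_group C X Y)"
    using assms by (auto simp: Hom_group_def)
  define d where "d = g \<otimes>\<^bsub>Hom_group C X Y\<^esub> inv\<^bsub>Hom_group C X Y\<^esub> h"
  have d: "d \<in> carrier (Hom_group C X Y)" using gh by (simp add: d_def)
  have dh: "d \<otimes>\<^bsub>Hom_group C X Y\<^esub> h = g" using gh by (simp add: d_def m_assoc)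
  have "g = h" if "d = \<one>\<^bsub>Hom_group C X Y\<^esub>" using that dh gh by simp
  then show thesis using that d dh by (simp add: Hom_group_def)
qed

lemma add_cancel_zero:
  assumes "d \<in> Hom C X Y" "h \<in> Hom C X Y" "AddArr C d h = h"
  shows "d = ZeroArr C X Y"
proof -
  interpret comm_group "Hom_group C X Y" using Hom_comm_group assms Hom_Obj by blast
  show ?thesis using assms r_cancel_one[of h d] by (simp add: Hom_group_def)
qed

lemma monicI:
  assumes f: "f \<in> Hom C X Y"
    and zero: "\<And>W g. \<lbrakk>g \<in> Hom C W X; f \<cdot> g = ZeroArr C W Y\<rbrakk> \<Longrightarrow> g = ZeroArr C W X"
  shows "monic C f"
proof -
  have "g = h" if g: "g \<in> Hom C W X" and h: "h \<in> Hom C W X" and eq: "f \<cdot> g = f \<cdot> h" for W g h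
  proof -
    obtain d where d: "d \<in> Hom C W X" "AddArr C d h = g" "d = ZeroArr C W X \<Longrightarrow> g = h"
      using diff_ex g h by blast
    have "AddArr C (f \<cdot> d) (f \<cdot> h) = f \<cdot> h" using d g h eq f Comp_add_right by metis
    then have "f \<cdot> d = ZeroArr C W Y" using add_cancel_zero Comp_Hom d h f by meson
    then show ?thesis using d zero by blast
  qed
  then show ?thesis using HomD[OF f] unfolding monic_def by metis
qed

lemma epicI:
  assumes f: "f \<in> Hom C X Y"
    and zero: "\<And>Z g. \<lbrakk>g \<in> Hom C Y Z; g \<cdot> f = ZeroArr C X Z\<rbrakk> \<Longrightarrow> g = ZeroArr C Y Z"
  shows "epic C f"
proof -
  have "g = h" if g: "g \<in> Hom C Y Z" and h: "h \<in> Hom C Y Z" and eq: "g \<cdot> f = h \<cdot> f" for Z g h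
  proof -
    obtain d where d: "d \<in> Hom C Y Z" "AddArr C d h = g" "d = ZeroArr C Y Z \<Longrightarrow> g = h"
      using diff_ex g h by blast
    have "AddArr C (d \<cdot> f) (h \<cdot> f) = h \<cdot> f" using d g h eq f Comp_add_left by metis
    then have "d \<cdot> f = ZeroArr C X Z" using add_cancel_zero Comp_Hom d h f by meson
    then show ?thesis using d zero by blast
  qed
  then show ?thesis using HomD[OF f] unfolding epic_def by metis
qed

lemma monicD:
  assumes "monic C f" "f \<in> Hom C X Y" "g \<in> Hom C W X" "f \<cdot> g = ZeroArr C W Y"
  shows "g = ZeroArr C W X"
  using assms monic_cancel comp_zero_right zero_Hom Hom_Obj by metis

lemma epicD:
  assumes "epic C f" "f \<in> Hom C X Y" "g \<in> Hom C Y Z" "g \<cdot> f = ZeroArr C X Z"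
  shows "g = ZeroArr C Y Z"
  using assms epic_cancel comp_zero_left zero_Hom Hom_Obj by metis

lemma zero_comp_left:
  assumes "f \<cdot> g = ZeroArr C X Z" "g \<in> Hom C X Y" "f \<in> Hom C Y Z" "h \<in> Hom C Z W"
  shows "(h \<cdot> f) \<cdot> g = ZeroArr C X W"
  using Comp_assoc[OF assms(2-4)] comp_zero_right[OF assms(4)] Hom_Obj[OF assms(2)] assms(1) by simp

lemma zero_comp_right:
  assumes "f \<cdot> g = ZeroArr C X Z" "g \<in> Hom C X Y" "f \<in> Hom C Y Z" "h \<in> Hom C W X"
  shows "f \<cdot> (g \<cdot> h) = ZeroArr C W Z"
  using Comp_assoc[OF assms(4,2,3)] comp_zero_left[OF assms(4)] Hom_Obj[OF assms(3)] assms(1) by simp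

text \<open>An identity that is zero annihilates every arrow into or out of \<open>Z\<close>. The
  criterion mentions no other object, so it passes between a category and a full subcategory at
  once.\<close>

lemma zero_object_iff: "zero_object C Z \<longleftrightarrow> Z \<in> Obj C \<and> Ident C Z = ZeroArr C Z Z"
proof
  assume "zero_object C Z"
  then show "Z \<in> Obj C \<and> Ident C Z = ZeroArr C Z Z"
    unfolding zero_object_def using Ident_Hom zero_Hom by metis
next
  assume Z: "Z \<in> Obj C \<and> Ident C Z = ZeroArr C Z Z"
  have "f = ZeroArr C Z X" if "f \<in> Hom C Z X" for f X
    using that Z Comp_Ident_right comp_zero_right by metis
  moreover have "f = ZeroArr C X Z" if "f \<in> Hom C X Z" for f X
    using that Z Comp_Ident_left comp_zero_left by metis
  ultimately show "zero_object C Z"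
    unfolding zero_object_def using Z zero_Hom by metis
qed

lemma Hom_from_zero: "zero_object C X \<Longrightarrow> f \<in> Hom C X Y \<Longrightarrow> f = ZeroArr C X Y"
  using Comp_Ident_right comp_zero_right zero_object_iff by metis

lemma Hom_to_zero: "zero_object C Y \<Longrightarrow> f \<in> Hom C X Y \<Longrightarrow> f = ZeroArr C X Y"
  using Comp_Ident_left comp_zero_left zero_object_iff by metis

lemma zero_epic: "epic C f \<Longrightarrow> f \<in> Hom C X Y \<Longrightarrow> f = ZeroArr C X Y \<Longrightarrow> zero_object C Y"
  using zero_object_iff epicD Ident_Hom Comp_Ident_left Hom_Obj by metis

lemma zero_monic: "monic C f \<Longrightarrow> f \<in> Hom C X Y \<Longrightarrow> f = ZeroArr C X Y \<Longrightarrow> zero_object C X"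
  using zero_object_iff monicD Ident_Hom Comp_Ident_right Hom_Obj by metis

lemma zero_object_quotient: "zero_object C X \<Longrightarrow> f \<in> Hom C X Y \<Longrightarrow> epic C f \<Longrightarrow> zero_object C Y"
  using zero_epic Hom_from_zero by blast

lemma zero_object_sub: "zero_object C Y \<Longrightarrow> f \<in> Hom C X Y \<Longrightarrow> monic C f \<Longrightarrow> zero_object C X"
  using zero_monic Hom_to_zero by blast

lemma epic_to_zero: "zero_object C Y \<Longrightarrow> f \<in> Hom C X Y \<Longrightarrow> epic C f"
  using Hom_from_zero epicI by blast

lemma monic_from_zero: "zero_object C X \<Longrightarrow> f \<in> Hom C X Y \<Longrightarrow> monic C f"
  using Hom_to_zero monicI by blast

lemma kernelD:
  assumes "is_kernel C k f" "f \<in> Hom C X Y"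
  shows "k \<in> Hom C (Dom C k) X" "f \<cdot> k = ZeroArr C (Dom C k) Y" "monic C k"
proof -
  show k: "k \<in> Hom C (Dom C k) X" and fk: "f \<cdot> k = ZeroArr C (Dom C k) Y"
    using assms HomD[OF assms(2)] by (auto simp: is_kernel_def Hom_def)
  have "g = h" if "g \<in> Hom C W (Dom C k)" "h \<in> Hom C W (Dom C k)" "k \<cdot> g = k \<cdot> h" for W g h
  proof -
    have kg: "k \<cdot> g \<in> Hom C W X" using that k Comp_Hom by blast
    have "f \<cdot> (k \<cdot> g) = ZeroArr C W Y"
      using zero_comp_right[OF fk k assms(2)] that by blast
    then have "\<exists>!u. u \<in> Hom C W (Dom C k) \<and> k \<cdot> u = k \<cdot> g"
      using assms kg Hom_Obj[OF kg] HomD[OF assms(2)] by (simp add: is_kernel_def)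
    then show ?thesis using that by metis
  qed
  then show "monic C k" using HomD[OF k] unfolding monic_def by metis
qed

lemma cokernelD:
  assumes "is_cokernel C c f" "f \<in> Hom C X Y"
  shows "c \<in> Hom C Y (Cod C c)" "c \<cdot> f = ZeroArr C X (Cod C c)" "epic C c"
proof -
  show c: "c \<in> Hom C Y (Cod C c)" and cf: "c \<cdot> f = ZeroArr C X (Cod C c)"
    using assms HomD[OF assms(2)] by (auto simp: is_cokernel_def Hom_def)
  have "g = h" if "g \<in> Hom C (Cod C c) Z" "h \<in> Hom C (Cod C c) Z" "g \<cdot> c = h \<cdot> c" for Z g h
  proof -
    have gc: "g \<cdot> c \<in> Hom C Y Z" using that c Comp_Hom by blast
    have "(g \<cdot> c) \<cdot> f = ZeroArr C X Z"
      using zero_comp_left[OF cf assms(2) c] that by blast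
    then have "\<exists>!u. u \<in> Hom C (Cod C c) Z \<and> u \<cdot> c = g \<cdot> c"
      using assms gc Hom_Obj[OF gc] HomD[OF assms(2)] by (simp add: is_cokernel_def)
    then show ?thesis using that by metis
  qed
  then show "epic C c" using HomD[OF c] unfolding epic_def by metis
qed

lemma kernel_lift:
  assumes "is_kernel C k f" "f \<in> Hom C X Y" "k \<in> Hom C K X"
    and "g \<in> Hom C W X" "f \<cdot> g = ZeroArr C W Y"
  obtains u where "u \<in> Hom C W K" "k \<cdot> u = g"
  using assms Hom_Obj[OF assms(4)] HomD[OF assms(2)] HomD[OF assms(3)] that
  unfolding is_kernel_def by metis

lemma cokernel_lift:
  assumes "is_cokernel C c f" "f \<in> Hom C X Y" "c \<in> Hom C Y Q"
    and "g \<in> Hom C Y Z" "g \<cdot> f = ZeroArr C X Z"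
  obtains u where "u \<in> Hom C Q Z" "u \<cdot> c = g"
  using assms Hom_Obj[OF assms(4)] HomD[OF assms(2)] HomD[OF assms(3)] that
  unfolding is_cokernel_def by metis

text \<open>Uniqueness of the factorization follows from \<open>k\<close> being monic, so only
  existence is left to check.\<close>

lemma is_kernelI:
  assumes "k \<in> Hom C K X" "f \<in> Hom C X Y" "monic C k" "f \<cdot> k = ZeroArr C K Y"
    and lift: "\<And>W g. \<lbrakk>g \<in> Hom C W X; f \<cdot> g = ZeroArr C W Y\<rbrakk> \<Longrightarrow> \<exists>u \<in> Hom C W K. k \<cdot> u = g"
  shows "is_kernel C k f"
proof -
  have "\<exists>!u. u \<in> Hom C W K \<and> k \<cdot> u = g" if "g \<in> Hom C W X" "f \<cdot> g = ZeroArr C W Y" for W g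
    using lift[OF that] monic_cancel[OF assms(3,1)] by metis
  then show ?thesis
    using HomD[OF assms(1)] HomD[OF assms(2)] assms(4) by (simp add: is_kernel_def)
qed

lemma is_cokernelI:
  assumes "c \<in> Hom C Y Q" "f \<in> Hom C X Y" "epic C c" "c \<cdot> f = ZeroArr C X Q"
    and lift: "\<And>Z g. \<lbrakk>g \<in> Hom C Y Z; g \<cdot> f = ZeroArr C X Z\<rbrakk> \<Longrightarrow> \<exists>u \<in> Hom C Q Z. u \<cdot> c = g"
  shows "is_cokernel C c f"
proof -
  have "\<exists>!u. u \<in> Hom C Q Z \<and> u \<cdot> c = g" if "g \<in> Hom C Y Z" "g \<cdot> f = ZeroArr C X Z" for Z g
    using lift[OF that] epic_cancel[OF assms(3,1)] by metis
  then show ?thesis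
    using HomD[OF assms(1)] HomD[OF assms(2)] assms(4) by (simp add: is_cokernel_def)
qed

lemma short_exactD:
  assumes "short_exact C f g"
  shows "f \<in> Hom C (Dom C f) (Cod C f)" "g \<in> Hom C (Cod C f) (Cod C g)" "monic C f" "epic C g"
    "g \<cdot> f = ZeroArr C (Dom C f) (Cod C g)" "is_kernel C f g" "is_cokernel C g f"
proof -
  show *: "is_kernel C f g" "is_cokernel C g f" using assms by (auto simp: short_exact_def)
  show f: "f \<in> Hom C (Dom C f) (Cod C f)" and g: "g \<in> Hom C (Cod C f) (Cod C g)"
    using * by (auto simp: is_kernel_def Hom_def)
  show "monic C f" "g \<cdot> f = ZeroArr C (Dom C f) (Cod C g)"
    using kernelD[OF *(1) g] by auto
  show "epic C g" using cokernelD[OF *(2) f] by auto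
qed

end

text \<open>
  Products play no role in what follows.  Dropping them from the axioms makes a wide subcategory an
  instance of the same locale without any discussion of biproducts.
\<close>

locale preadditive_exact_category = preadditive_category C
  for C :: "('o, 'm, 'z) additive_cat_scheme" (structure) +
  assumes zero_object_ex: "\<exists>Z. zero_object C Z"
    and kernel_ex: "f \<in> Arr C \<Longrightarrow> \<exists>k. is_kernel C k f"
    and cokernel_ex: "f \<in> Arr C \<Longrightarrow> \<exists>c. is_cokernel C c f"
    and monic_is_kernel: "monic C f \<Longrightarrow> \<exists>g. is_kernel C f g"
    and epic_is_cokernel: "epic C f \<Longrightarrow> \<exists>g. is_cokernel C f g"
begin

section \<open>Normality of monics and epics, and image factorization\<close>

lemma kernel_obtain:
  assumes "f \<in> Hom C X Y"
  obtains K k where "is_kernel C k f" "k \<in> Hom C K X" "monic C k" "f \<cdot> k = ZeroArr C K Y"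
  using kernel_ex HomD[OF assms] kernelD[OF _ assms] by blast

lemma cokernel_obtain:
  assumes "f \<in> Hom C X Y"
  obtains Q c where "is_cokernel C c f" "c \<in> Hom C Y Q" "epic C c" "c \<cdot> f = ZeroArr C X Q"
  using cokernel_ex HomD[OF assms] cokernelD[OF _ assms] by blast

text \<open>The monic \<open>f\<close> is a kernel of some \<open>g\<close>, and \<open>g\<close>
  vanishes because \<open>f\<close> is epic. The identity of \<open>Y\<close> therefore factors
  through \<open>f\<close>, which gives a right inverse; cancelling \<open>f\<close> makes it
  two-sided.\<close>

lemma monic_epic_iso:
  assumes "monic C f" "epic C f" "f \<in> Hom C X Y"
  shows "iso_arrow C f"
proof -
  obtain g where g: "is_kernel C f g" using monic_is_kernel assms by blast
  define Z where "Z = Cod C g"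
  have gH: "g \<in> Hom C Y Z" using g HomD[OF assms(3)] by (auto simp: is_kernel_def Hom_def Z_def)
  have "g \<cdot> f = ZeroArr C X Z" using kernelD(2)[OF g gH] HomD[OF assms(3)] by simp
  then have "g = ZeroArr C Y Z" using epicD assms gH by blast
  then have "g \<cdot> Ident C Y = ZeroArr C Y Z" using Comp_Ident_right gH by metis
  then obtain u where u: "u \<in> Hom C Y X" "f \<cdot> u = Ident C Y"
    using kernel_lift[OF g gH assms(3)] Ident_Hom Hom_Obj[OF assms(3)] by blast
  have "f \<cdot> (u \<cdot> f) = f \<cdot> Ident C X"
    using u Comp_assoc[OF assms(3) u(1) assms(3)] Comp_Ident_left[OF assms(3)]
      Comp_Ident_right[OF assms(3)] by simp
  then have "u \<cdot> f = Ident C X"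
    using monic_cancel assms u Comp_Hom Ident_Hom Hom_Obj by meson
  then show ?thesis using iso_arrowI u assms by blast
qed

text \<open>The epic \<open>e\<close> is the cokernel of some \<open>g\<close>, and \<open>g\<close>
  factors through \<open>k\<close> because \<open>e\<close> kills it. An arrow that kills
  \<open>k\<close> hence kills \<open>g\<close> and factors through \<open>e\<close>.\<close>

lemma epic_cokernel_of_kernel:
  assumes "epic C e" "e \<in> Hom C X Y" "is_kernel C k e"
  shows "is_cokernel C e k"
proof -
  define K where "K = Dom C k"
  note k = kernelD[OF assms(3,2), folded K_def]
  obtain g where g: "is_cokernel C e g" using epic_is_cokernel assms by blast
  define W where "W = Dom C g"
  have gH: "g \<in> Hom C W X" using g HomD[OF assms(2)] by (auto simp: is_cokernel_def Hom_def W_def)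
  have "e \<cdot> g = ZeroArr C W Y" using cokernelD(2)[OF g gH] HomD[OF assms(2)] by simp
  then obtain v where v: "v \<in> Hom C W K" "k \<cdot> v = g"
    using kernel_lift[OF assms(3,2) k(1) gH] by blast
  show ?thesis
  proof (rule is_cokernelI[OF assms(2) k(1) assms(1) k(2)])
    fix Z h assume h: "h \<in> Hom C X Z" "h \<cdot> k = ZeroArr C K Z"
    then have "h \<cdot> g = ZeroArr C W Z" using zero_comp_right[OF h(2) k(1) h(1) v(1)] v by simp
    then show "\<exists>u \<in> Hom C Y Z. u \<cdot> e = h"
      using cokernel_lift[OF g gH assms(2) h(1)] by blast
  qed
qed

lemma monic_kernel_of_cokernel:
  assumes "monic C m" "m \<in> Hom C X Y" "is_cokernel C c m"
  shows "is_kernel C m c"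
proof -
  define Q where "Q = Cod C c"
  note c = cokernelD[OF assms(3,2), folded Q_def]
  obtain g where g: "is_kernel C m g" using monic_is_kernel assms by blast
  define Z where "Z = Cod C g"
  have gH: "g \<in> Hom C Y Z" using g HomD[OF assms(2)] by (auto simp: is_kernel_def Hom_def Z_def)
  have "g \<cdot> m = ZeroArr C X Z" using kernelD(2)[OF g gH] HomD[OF assms(2)] by simp
  then obtain v where v: "v \<in> Hom C Q Z" "v \<cdot> c = g"
    using cokernel_lift[OF assms(3,2) c(1) gH] by blast
  show ?thesis
  proof (rule is_kernelI[OF assms(2) c(1) assms(1) c(2)])
    fix W h assume h: "h \<in> Hom C W Y" "c \<cdot> h = ZeroArr C W Q"
    then have "g \<cdot> h = ZeroArr C W Z" using zero_comp_left[OF h(2) h(1) c(1) v(1)] v by simp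
    then show "\<exists>u \<in> Hom C W X. m \<cdot> u = h"
      using kernel_lift[OF g gH assms(2) h(1)] by blast
  qed
qed

lemma short_exact_of_monic:
  assumes "monic C m" "m \<in> Hom C X Y"
  obtains Q c where "short_exact C m c" "c \<in> Hom C Y Q" "epic C c" "c \<cdot> m = ZeroArr C X Q"
  using cokernel_obtain[OF assms(2)] monic_kernel_of_cokernel[OF assms]
  unfolding short_exact_def by metis

lemma short_exact_of_epic:
  assumes "epic C e" "e \<in> Hom C X Y"
  obtains K k where "short_exact C k e" "k \<in> Hom C K X" "monic C k" "e \<cdot> k = ZeroArr C K Y"
  using kernel_obtain[OF assms(2)] epic_cokernel_of_kernel[OF assms]
  unfolding short_exact_def by metis

text \<open>The image is the kernel \<open>m\<close> of the cokernel \<open>c\<close> of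
  \<open>f\<close>; the content is that \<open>e\<close> is epic. If \<open>g\<close> kills
  \<open>e\<close>, then \<open>e\<close> factors through the kernel \<open>n\<close> of
  \<open>g\<close>, so \<open>f\<close> factors through \<open>m \<cdot> n\<close>. The cokernel
  \<open>p\<close> of \<open>m \<cdot> n\<close> thus kills \<open>f\<close>, factors through
  \<open>c\<close> and kills \<open>m\<close>. Hence \<open>m\<close> factors through
  \<open>m \<cdot> n\<close>, which makes \<open>n\<close> split epic and \<open>g\<close>
  zero.\<close>

lemma image_factorization:
  assumes f: "f \<in> Hom C X Y"
  obtains I e m where "e \<in> Hom C X I" "epic C e" "m \<in> Hom C I Y" "monic C m" "f = m \<cdot> e"
proof -
  obtain Q c where c: "is_cokernel C c f" "c \<in> Hom C Y Q" "epic C c" "c \<cdot> f = ZeroArr C X Q"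
    using cokernel_obtain[OF f] by blast
  obtain I m where m: "is_kernel C m c" "m \<in> Hom C I Y" "monic C m" "c \<cdot> m = ZeroArr C I Q"
    using kernel_obtain[OF c(2)] by blast
  obtain e where e: "e \<in> Hom C X I" "m \<cdot> e = f"
    using kernel_lift[OF m(1) c(2) m(2) f c(4)] by blast
  have "epic C e"
  proof (rule epicI[OF e(1)])
    fix Z g assume g: "g \<in> Hom C I Z" "g \<cdot> e = ZeroArr C X Z"
    obtain N n where n: "is_kernel C n g" "n \<in> Hom C N I" "monic C n" "g \<cdot> n = ZeroArr C N Z"
      using kernel_obtain[OF g(1)] by blast
    obtain e' where e': "e' \<in> Hom C X N" "n \<cdot> e' = e"
      using kernel_lift[OF n(1) g(1) n(2) e(1) g(2)] by blast
    have mn: "m \<cdot> n \<in> Hom C N Y" using m n Comp_Hom by blast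
    have "monic C (m \<cdot> n)" using monic_comp m n by blast
    then obtain P p where p: "short_exact C (m \<cdot> n) p" "p \<in> Hom C Y P" "p \<cdot> (m \<cdot> n) = ZeroArr C N P"
      using short_exact_of_monic mn by metis
    have "f = (m \<cdot> n) \<cdot> e'" using e e' Comp_assoc[OF e'(1) n(2) m(2)] by simp
    then have "p \<cdot> f = ZeroArr C X P"
      using zero_comp_right[OF p(3) mn p(2) e'(1)] by simp
    then obtain r where r: "r \<in> Hom C Q P" "r \<cdot> c = p"
      using cokernel_lift[OF c(1) f c(2) p(2)] by blast
    have "p \<cdot> m = ZeroArr C I P" using zero_comp_left[OF m(4,2) c(2) r(1)] r(2) by simp
    moreover have "is_kernel C (m \<cdot> n) p" using p by (simp add: short_exact_def)
    ultimately obtain w where w: "w \<in> Hom C I N" "(m \<cdot> n) \<cdot> w = m"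
      using kernel_lift p mn m by metis
    have "m \<cdot> (n \<cdot> w) = m \<cdot> Ident C I"
      using w Comp_assoc[OF w(1) n(2) m(2)] Comp_Ident_right[OF m(2)] by simp
    then have nw: "n \<cdot> w = Ident C I"
      using monic_cancel m n w Comp_Hom Ident_Hom Hom_Obj by meson
    then show "g = ZeroArr C I Z"
      using zero_comp_right[OF n(4,2) g(1) w(1)] Comp_Ident_right[OF g(1)] by simp
  qed
  then show thesis using that e m by blast
qed

lemma short_exact_HomD:
  assumes "short_exact C f g" "f \<in> Hom C X Y" "g \<in> Hom C Y Z"
  shows "monic C f" "epic C g" "g \<cdot> f = ZeroArr C X Z" "is_kernel C f g" "is_cokernel C g f"
  using short_exactD(3-)[OF assms(1)] HomD(2,3)[OF assms(2)] HomD(3)[OF assms(3)] by simp_all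

end

lemma (in abelian_category) preadditive_exact: "preadditive_exact_category C"
  using preadditive_category_axioms zero_object_ex kernel_ex cokernel_ex monic_is_kernel
    epic_is_cokernel
  by (intro preadditive_exact_category.intro preadditive_exact_category_axioms.intro)

section \<open>Diagram constructions on short exact sequences\<close>

context preadditive_exact_category
begin

lemma iso_if_zero_cokernel:
  assumes "short_exact C i p" "i \<in> Hom C X Y" "p \<in> Hom C Y Z" "zero_object C Z"
  shows "iso_arrow C i"
proof (rule monic_epic_iso[OF _ _ assms(2)])
  note ip = short_exact_HomD[OF assms(1-3)]
  show "monic C i" by (fact ip(1))
  show "epic C i"
  proof (rule epicI[OF assms(2)])
    fix W g assume g: "g \<in> Hom C Y W" "g \<cdot> i = ZeroArr C X W"
    obtain u where u: "u \<in> Hom C Z W" "u \<cdot> p = g"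
      using cokernel_lift[OF ip(5) assms(2,3) g] .
    have "u = ZeroArr C Z W" using Hom_from_zero[OF assms(4) u(1)] .
    then show "g = ZeroArr C Y W"
      using u comp_zero_left[OF assms(3)] Hom_Obj[OF u(1)] by simp
  qed
qed

text \<open>This is the pullback of \<open>p\<close> along a subobject \<open>m\<close> of
  \<open>Q\<close>, built without products as the kernel of \<open>p\<close> followed by the
  cokernel of \<open>m\<close>. It remains an extension of \<open>I\<close> by the same
  \<open>A\<close>, which lets subobjects of a quotient be lifted inside a class closed under
  extensions.\<close>

lemma preimage:
  assumes "short_exact C i p" and i: "i \<in> Hom C A B" and p: "p \<in> Hom C B Q"
    and m: "m \<in> Hom C I Q" "monic C m"
  obtains K k j q where "k \<in> Hom C K B" "monic C k" "j \<in> Hom C A K" "q \<in> Hom C K I"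
    "short_exact C j q" "k \<cdot> j = i" "p \<cdot> k = m \<cdot> q"
proof -
  note ip = short_exact_HomD[OF assms(1-3)]
  obtain R c where c: "short_exact C m c" "c \<in> Hom C Q R" "epic C c" "c \<cdot> m = ZeroArr C I R"
    using short_exact_of_monic[OF m(2,1)] .
  have cp: "c \<cdot> p \<in> Hom C B R" using Comp_Hom[OF p c(2)] .
  obtain K k where k: "is_kernel C k (c \<cdot> p)" "k \<in> Hom C K B" "monic C k"
      "(c \<cdot> p) \<cdot> k = ZeroArr C K R"
    using kernel_obtain[OF cp] .
  have pk: "p \<cdot> k \<in> Hom C K Q" using Comp_Hom[OF k(2) p] .
  have "c \<cdot> (p \<cdot> k) = ZeroArr C K R" using k(4) Comp_assoc[OF k(2) p c(2)] by simp
  then obtain q where q: "q \<in> Hom C K I" "m \<cdot> q = p \<cdot> k"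
    using kernel_lift[OF short_exact_HomD(4)[OF c(1) m(1) c(2)] c(2) m(1) pk] by blast
  have "(c \<cdot> p) \<cdot> i = ZeroArr C A R" using zero_comp_left[OF ip(3) i p c(2)] .
  then obtain j where j: "j \<in> Hom C A K" "k \<cdot> j = i"
    using kernel_lift[OF k(1) cp k(2) i] by blast
  have "m \<cdot> (q \<cdot> j) = p \<cdot> i"
    using Comp_assoc[OF j(1) q(1) m(1)] Comp_assoc[OF j(1) k(2) p] q j by simp
  then have qj: "q \<cdot> j = ZeroArr C A I"
    using monicD[OF m(2,1) Comp_Hom[OF j(1) q(1)]] ip(3) by simp
  have ker: "is_kernel C j q"
  proof (rule is_kernelI[OF j(1) q(1) _ qj])
    show "monic C j" using monic_right_factor[OF _ j(1) k(2)] j(2) ip(1) by simp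
    fix W g assume g: "g \<in> Hom C W K" "q \<cdot> g = ZeroArr C W I"
    have kg: "k \<cdot> g \<in> Hom C W B" using Comp_Hom[OF g(1) k(2)] .
    have "p \<cdot> (k \<cdot> g) = m \<cdot> (q \<cdot> g)"
      using Comp_assoc[OF g(1) k(2) p] Comp_assoc[OF g(1) q(1) m(1)] q(2) by simp
    then have "p \<cdot> (k \<cdot> g) = ZeroArr C W Q"
      using g comp_zero_right[OF m(1)] Hom_Obj[OF g(1)] by simp
    then obtain v where v: "v \<in> Hom C W A" "i \<cdot> v = k \<cdot> g"
      using kernel_lift[OF ip(4) p i kg] by blast
    have "k \<cdot> (j \<cdot> v) = k \<cdot> g" using v Comp_assoc[OF v(1) j(1) k(2)] j by simp
    then have "j \<cdot> v = g" using monic_cancel[OF k(3,2) Comp_Hom[OF v(1) j(1)] g(1)] by simp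
    then show "\<exists>u \<in> Hom C W A. j \<cdot> u = g" using v by blast
  qed
  \<comment> \<open>If \<open>q\<close> had the smaller image \<open>n\<close>, the cokernel
    \<open>d\<close> of \<open>m \<cdot> n\<close> would satisfy
    \<open>(d \<cdot> p) \<cdot> k = 0\<close>. As \<open>c \<cdot> p\<close> is the cokernel of
    \<open>k\<close> and \<open>p\<close> is epic, \<open>d\<close> factors through \<open>c\<close>
    and kills \<open>m\<close>; so \<open>m\<close> factors through \<open>m \<cdot> n\<close>, and
    \<open>n\<close> is split epic.\<close>
  have "epic C q"
  proof -
    obtain J e n where n: "e \<in> Hom C K J" "epic C e" "n \<in> Hom C J I" "monic C n" "q = n \<cdot> e"
      using image_factorization[OF q(1)] .
    have mn: "m \<cdot> n \<in> Hom C J Q" "monic C (m \<cdot> n)"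
      using Comp_Hom[OF n(3) m(1)] monic_comp[OF n(4) m(2) n(3) m(1)] by auto
    obtain R' d where d: "short_exact C (m \<cdot> n) d" "d \<in> Hom C Q R'" "epic C d"
        "d \<cdot> (m \<cdot> n) = ZeroArr C J R'"
      using short_exact_of_monic[OF mn(2,1)] .
    have dp: "d \<cdot> p \<in> Hom C B R'" using Comp_Hom[OF p d(2)] .
    have "p \<cdot> k = (m \<cdot> n) \<cdot> e" using q(2) n(5) Comp_assoc[OF n(1) n(3) m(1)] by simp
    then have "(d \<cdot> p) \<cdot> k = ZeroArr C K R'"
      using zero_comp_right[OF d(4) mn(1) d(2) n(1)] Comp_assoc[OF k(2) p d(2)] by simp
    moreover have "is_cokernel C (c \<cdot> p) k"
      using epic_cokernel_of_kernel[OF epic_comp[OF ip(2) c(3) p c(2)] cp k(1)] .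
    ultimately obtain s where s: "s \<in> Hom C R R'" "s \<cdot> (c \<cdot> p) = d \<cdot> p"
      using cokernel_lift[OF _ k(2) cp dp] by blast
    have "(s \<cdot> c) \<cdot> p = d \<cdot> p" using s Comp_assoc[OF p c(2) s(1)] by simp
    then have "s \<cdot> c = d" using epic_cancel[OF ip(2) p Comp_Hom[OF c(2) s(1)] d(2)] by simp
    then have "d \<cdot> m = ZeroArr C I R'" using zero_comp_left[OF c(4) m(1) c(2) s(1)] by simp
    then obtain w where w: "w \<in> Hom C I J" "(m \<cdot> n) \<cdot> w = m"
      using kernel_lift[OF short_exact_HomD(4)[OF d(1) mn(1) d(2)] d(2) mn(1) m(1)] by blast
    have "m \<cdot> (n \<cdot> w) = m \<cdot> Ident C I"
      using w Comp_assoc[OF w(1) n(3) m(1)] Comp_Ident_right[OF m(1)] by simp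
    moreover have I: "I \<in> Obj C" using Hom_Obj[OF m(1)] by simp
    ultimately have "n \<cdot> w = Ident C I"
      using monic_cancel[OF m(2,1) Comp_Hom[OF w(1) n(3)] Ident_Hom[OF I]] by simp
    then have "epic C n"
      using epic_left_factor[OF _ w(1) n(3)] iso_arrow_epic[OF iso_arrow_Ident[OF I]] by simp
    then show ?thesis using epic_comp[OF n(2) _ n(1,3)] n(5) by simp
  qed
  then have "short_exact C j q"
    using ker epic_cokernel_of_kernel[OF _ q(1) ker] by (simp add: short_exact_def)
  then show thesis using that[OF k(2,3) j(1) q(1)] j(2) q(2) by simp
qed

text \<open>A quotient \<open>Q\<close> of an extension is filtered by the image \<open>I\<close> of
  \<open>L\<close>, and the arrow from \<open>M\<close> to the cokernel \<open>R\<close> kills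
  \<open>L\<close>, hence factors through \<open>N\<close>. Every proof below that a class defined
  by conditions on quotients is closed under extensions rests on this.\<close>

lemma extension_quotient:
  assumes "short_exact C i p" and i: "i \<in> Hom C L M" and p: "p \<in> Hom C M N"
    and e: "e \<in> Hom C M Q" "epic C e"
  obtains I R a b c r where "a \<in> Hom C L I" "epic C a" "b \<in> Hom C I Q" "c \<in> Hom C Q R"
    "short_exact C b c" "r \<in> Hom C N R" "epic C r"
proof -
  note ip = short_exact_HomD[OF assms(1-3)]
  obtain I a b where ab: "a \<in> Hom C L I" "epic C a" "b \<in> Hom C I Q" "monic C b" "e \<cdot> i = b \<cdot> a"
    using image_factorization[OF Comp_Hom[OF i e(1)]] .
  obtain R c where c: "short_exact C b c" "c \<in> Hom C Q R" "epic C c" "c \<cdot> b = ZeroArr C I R"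
    using short_exact_of_monic[OF ab(4,3)] .
  have ce: "c \<cdot> e \<in> Hom C M R" using Comp_Hom[OF e(1) c(2)] .
  have "(c \<cdot> e) \<cdot> i = (c \<cdot> b) \<cdot> a"
    using Comp_assoc[OF i e(1) c(2)] ab(5) Comp_assoc[OF ab(1,3) c(2)] by simp
  then have "(c \<cdot> e) \<cdot> i = ZeroArr C L R"
    using c(4) comp_zero_left[OF ab(1)] Hom_Obj[OF c(2)] by simp
  then obtain r where r: "r \<in> Hom C N R" "r \<cdot> p = c \<cdot> e"
    using cokernel_lift[OF ip(5) i p ce] by blast
  have "epic C r"
    using epic_left_factor[OF _ p r(1)] epic_comp[OF e(2) c(3) e(1) c(2)] r(2) by simp
  then show thesis using that[OF ab(1-3) c(2,1) r(1)] by simp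
qed

section \<open>Schur's lemma\<close>

lemma simple_objectD:
  assumes "simple_object C S" "m \<in> Hom C X S" "monic C m"
  shows "zero_object C X \<or> iso_arrow C m"
  using assms HomD[OF assms(2)] by (auto simp: simple_object_def)

text \<open>The image is a nonzero subobject of \<open>S\<close>, hence all of it.\<close>

lemma simple_object_epic:
  assumes "simple_object C S" "f \<in> Hom C X S" "f \<noteq> ZeroArr C X S"
  shows "epic C f"
proof -
  obtain I e m where em: "e \<in> Hom C X I" "epic C e" "m \<in> Hom C I S" "monic C m" "f = m \<cdot> e"
    using image_factorization[OF assms(2)] .
  have "\<not> zero_object C I"
  proof
    assume "zero_object C I"
    then have "m = ZeroArr C I S" using Hom_from_zero em by blast
    then show False using assms em comp_zero_left[OF em(1)] Hom_Obj[OF em(3)] by simp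
  qed
  then have "iso_arrow C m" using simple_objectD[OF assms(1) em(3,4)] by simp
  then show ?thesis using iso_arrow_epic epic_comp[OF em(2) _ em(1,3)] em(5) by simp
qed

lemma simple_object_monic:
  assumes "simple_object C S" "f \<in> Hom C S Y" "f \<noteq> ZeroArr C S Y"
  shows "monic C f"
proof -
  obtain K k where k: "is_kernel C k f" "k \<in> Hom C K S" "monic C k" "f \<cdot> k = ZeroArr C K Y"
    using kernel_obtain[OF assms(2)] .
  have "\<not> iso_arrow C k"
    using epicD[OF iso_arrow_epic k(2) assms(2) k(4)] assms(3) by blast
  then have "zero_object C K" using simple_objectD[OF assms(1) k(2,3)] by simp
  then have k0: "k = ZeroArr C K S" using Hom_from_zero[OF _ k(2)] by simp
  show ?thesis
  proof (rule monicI[OF assms(2)])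
    fix W g assume g: "g \<in> Hom C W S" "f \<cdot> g = ZeroArr C W Y"
    obtain u where u: "u \<in> Hom C W K" "k \<cdot> u = g" using kernel_lift[OF k(1) assms(2) k(2) g] .
    show "g = ZeroArr C W S"
      using u k0 comp_zero_left[OF u(1)] Hom_Obj[OF g(1)] by simp
  qed
qed

lemma simple_object_iso:
  "simple_object C S \<Longrightarrow> f \<in> Hom C S S \<Longrightarrow> f \<noteq> ZeroArr C S S \<Longrightarrow> iso_arrow C f"
  using monic_epic_iso simple_object_epic simple_object_monic by blast


section \<open>Bricks and torsion classes\<close>

lemma ring_End_ring:
  assumes "B \<in> Obj C"
  shows "ring (End_ring C B)"
proof (rule ring.intro)
  have "add_monoid (End_ring C B) = Hom_group C B B"
    by (simp add: End_ring_def Hom_group_def)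
  then show "abelian_group (End_ring C B)"
    using Hom_comm_group[OF assms assms] by (metis comm_group_abelian_groupI)
  show "Group.monoid (End_ring C B)"
    by (rule monoidI)
      (auto simp: End_ring_def assms Ident_Hom Comp_Hom Comp_assoc Comp_Ident_left Comp_Ident_right)
  show "ring_axioms (End_ring C B)"
    by (rule ring_axioms.intro) (auto simp: End_ring_def Comp_add_left Comp_add_right)
qed

text \<open>The units of the endomorphism ring are the invertible endomorphisms, and one equals zero
  there exactly when \<open>B\<close> is a zero object. From here on bricks are handled through
  arrows instead of rings.\<close>

lemma brick_iff:
  "brick C B \<longleftrightarrow> B \<in> Obj C \<and> \<not> zero_object C B \<and>
     (\<forall>f \<in> Hom C B B. f \<noteq> ZeroArr C B B \<longrightarrow> iso_arrow C f)"
proof (cases "B \<in> Obj C \<and> \<not> zero_object C B")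
  case True
  then have B: "B \<in> Obj C" and id: "Ident C B \<noteq> ZeroArr C B B" by (auto simp: zero_object_iff)
  have units: "Units (End_ring C B) = {f \<in> Hom C B B. iso_arrow C f}"
    by (auto simp: Units_def End_ring_def iso_arrow_def Hom_def)
  have "\<not> iso_arrow C (ZeroArr C B B)"
    using True zero_epic[OF iso_arrow_epic zero_Hom[OF B B]] by blast
  then have "Units (End_ring C B) = carrier (End_ring C B) - {\<zero>\<^bsub>End_ring C B\<^esub>} \<longleftrightarrow>
      (\<forall>f \<in> Hom C B B. f \<noteq> ZeroArr C B B \<longrightarrow> iso_arrow C f)"
    unfolding units by (auto simp: End_ring_def)
  then show ?thesis
    using True id ring_End_ring[OF B] by (simp add: brick_def division_ring_def End_ring_def)
next
  case False
  then show ?thesis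
    by (auto simp: brick_def division_ring_def End_ring_def zero_object_iff)
qed

lemma simple_object_brick: "simple_object C S \<Longrightarrow> brick C S"
  using simple_object_iso by (simp add: brick_iff simple_object_def)

section \<open>Torsion classes and perpendicular classes\<close>

lemma torsI:
  assumes "T \<subseteq> Obj C" "T \<noteq> {}"
    and factor: "\<And>X Y e. \<lbrakk>X \<in> T; e \<in> Hom C X Y; epic C e\<rbrakk> \<Longrightarrow> Y \<in> T"
    and ext: "\<And>A B Q i p. \<lbrakk>short_exact C i p; i \<in> Hom C A B; p \<in> Hom C B Q; A \<in> T; Q \<in> T\<rbrakk>
      \<Longrightarrow> B \<in> T"
  shows "T \<in> tors C"
proof -
  have "subcategory C T"
    unfolding subcategory_def isomorphic_def using assms(1) factor iso_arrow_epic by blast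
  moreover have "closed_extensions C T"
    unfolding closed_extensions_def using ext short_exactD(1,2) by blast
  moreover have "closed_factors C T"
    unfolding closed_factors_def
  proof (intro allI impI)
    fix f assume f: "epic C f \<and> Dom C f \<in> T"
    then have "f \<in> Hom C (Dom C f) (Cod C f)" by (simp add: epic_def HomI)
    then show "Cod C f \<in> T" using factor f by blast
  qed
  ultimately show ?thesis using assms(2) by (simp add: tors_def torsion_class_def)
qed

lemma tors_Obj: "T \<in> tors C \<Longrightarrow> X \<in> T \<Longrightarrow> X \<in> Obj C"
  by (auto simp: tors_def torsion_class_def subcategory_def)

lemma tors_factor: "T \<in> tors C \<Longrightarrow> X \<in> T \<Longrightarrow> e \<in> Hom C X Y \<Longrightarrow> epic C e \<Longrightarrow> Y \<in> T"
  by (auto simp: tors_def torsion_class_def closed_factors_def Hom_def)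

lemma tors_ext:
  "T \<in> tors C \<Longrightarrow> short_exact C i p \<Longrightarrow> i \<in> Hom C A B \<Longrightarrow> p \<in> Hom C B Q \<Longrightarrow> A \<in> T \<Longrightarrow> Q \<in> T
    \<Longrightarrow> B \<in> T"
  by (auto simp: tors_def torsion_class_def closed_extensions_def Hom_def)

lemma tors_zero:
  assumes "T \<in> tors C" "zero_object C Z"
  shows "Z \<in> T"
proof -
  obtain X where X: "X \<in> T" using assms by (auto simp: tors_def torsion_class_def)
  then have "ZeroArr C X Z \<in> Hom C X Z"
    using zero_Hom tors_Obj assms by (simp add: zero_object_def)
  then show ?thesis using tors_factor[OF assms(1) X] epic_to_zero[OF assms(2)] by blast
qed

lemma tors_Obj_mem: "Obj C \<in> tors C"
  using zero_object_ex Hom_Obj by (intro torsI) (auto simp: zero_object_def)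

lemma tors_zero_objects: "{Z. zero_object C Z} \<in> tors C"
proof (rule torsI)
  show "{Z. zero_object C Z} \<subseteq> Obj C" by (auto simp: zero_object_def)
  show "{Z. zero_object C Z} \<noteq> {}" using zero_object_ex by blast
next
  fix X Y e assume "X \<in> {Z. zero_object C Z}" "e \<in> Hom C X Y" "epic C e"
  then show "Y \<in> {Z. zero_object C Z}" using zero_object_quotient by blast
next
  fix A B Q i p
  assume "short_exact C i p" "i \<in> Hom C A B" "p \<in> Hom C B Q" "A \<in> {Z. zero_object C Z}"
    "Q \<in> {Z. zero_object C Z}"
  then show "B \<in> {Z. zero_object C Z}"
    using iso_if_zero_cokernel iso_arrow_epic zero_object_quotient by blast
qed

lemma tors_Inter:
  assumes "F \<subseteq> tors C" "F \<noteq> {}"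
  shows "\<Inter>F \<in> tors C"
proof (rule torsI)
  show "\<Inter>F \<subseteq> Obj C" using assms tors_Obj by blast
  show "\<Inter>F \<noteq> {}" using zero_object_ex tors_zero assms by blast
next
  fix X Y e assume "X \<in> \<Inter>F" "e \<in> Hom C X Y" "epic C e"
  then show "Y \<in> \<Inter>F" using assms tors_factor[OF _ _ \<open>e \<in> Hom C X Y\<close>] by blast
next
  fix A B Q i p
  assume "short_exact C i p" "i \<in> Hom C A B" "p \<in> Hom C B Q" "A \<in> \<Inter>F" "Q \<in> \<Inter>F"
  then show "B \<in> \<Inter>F" using assms tors_ext[OF _ \<open>short_exact C i p\<close>] by blast
qed

text \<open>These are the test classes for maximality. Intersecting such a class with
  \<open>T\<close> shows that nonzero arrows into \<open>Y\<close> must exist, and for simple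
  \<open>Y\<close> the class is itself maximal among the proper torsion classes.\<close>

lemma tors_left_perp:
  assumes "Y \<in> Obj C"
  shows "{X \<in> Obj C. Hom C X Y = {ZeroArr C X Y}} \<in> tors C" (is "?T \<in> _")
proof -
  have T: "X \<in> ?T \<longleftrightarrow> X \<in> Obj C \<and> (\<forall>f \<in> Hom C X Y. f = ZeroArr C X Y)" for X
    using zero_Hom assms by blast
  show ?thesis
  proof (rule torsI)
    show "?T \<subseteq> Obj C" by blast
    obtain Z where "zero_object C Z" using zero_object_ex by blast
    then have "Z \<in> ?T" using T Hom_from_zero by (auto simp: zero_object_def)
    then show "?T \<noteq> {}" by blast
  next
    fix X X' e assume X: "X \<in> ?T" and e: "e \<in> Hom C X X'" "epic C e"
    have "f = ZeroArr C X' Y" if f: "f \<in> Hom C X' Y" for f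
      using epicD[OF e(2,1) f] X T Comp_Hom[OF e(1) f] by blast
    then show "X' \<in> ?T" using T Hom_Obj[OF e(1)] by blast
  next
    fix A B Q i p
    assume ex: "short_exact C i p" and i: "i \<in> Hom C A B" and p: "p \<in> Hom C B Q"
      and A: "A \<in> ?T" and Q: "Q \<in> ?T"
    note ip = short_exact_HomD[OF ex i p]
    have "f = ZeroArr C B Y" if f: "f \<in> Hom C B Y" for f
    proof -
      have "f \<cdot> i = ZeroArr C A Y" using A T Comp_Hom[OF i f] by blast
      then obtain u where u: "u \<in> Hom C Q Y" "u \<cdot> p = f"
        using cokernel_lift[OF ip(5) i p f] by blast
      then have "u = ZeroArr C Q Y" using Q T by blast
      then show ?thesis using u comp_zero_left[OF p] assms by simp
    qed
    then show "B \<in> ?T" using T Hom_Obj[OF i] by blast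
  qed
qed

lemma right_perp_iff:
  assumes "S \<subseteq> Obj C"
  shows "Y \<in> right_perp C S \<longleftrightarrow> Y \<in> Obj C \<and> (\<forall>X \<in> S. \<forall>f \<in> Hom C X Y. f = ZeroArr C X Y)"
  unfolding right_perp_def using zero_Hom assms by blast

lemma right_perp_sub:
  assumes "S \<subseteq> Obj C" "Y \<in> right_perp C S" "m \<in> Hom C Y' Y" "monic C m"
  shows "Y' \<in> right_perp C S"
proof -
  have "f = ZeroArr C X Y'" if "X \<in> S" and f: "f \<in> Hom C X Y'" for X f
    using monicD[OF assms(4,3) f] that assms(1,2) Comp_Hom[OF f assms(3)] right_perp_iff by blast
  then show ?thesis using right_perp_iff[OF assms(1)] Hom_Obj[OF assms(3)] by blast
qed

lemma right_perp_zero: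
  assumes "S \<subseteq> Obj C" "zero_object C Z"
  shows "Z \<in> right_perp C S"
  using assms Hom_to_zero right_perp_iff by (auto simp: zero_object_def)

lemma right_perp_meet_zero:
  assumes "S \<subseteq> Obj C" "X \<in> S" "X \<in> right_perp C S"
  shows "zero_object C X"
  using assms right_perp_iff[OF assms(1)] Ident_Hom by (auto simp: zero_object_iff)

end

text \<open>
  Finite length enters only through a size function that strictly decreases on proper subobjects
  and proper quotients.  Such a function restricts to wide subcategories.
\<close>

locale sized_exact_category = preadditive_exact_category C
  for C :: "('o, 'm, 'z) additive_cat_scheme" (structure) +
  fixes size :: "'o \<Rightarrow> nat"
  assumes size_monic: "\<lbrakk>m \<in> Hom C X Y; monic C m; \<not> iso_arrow C m\<rbrakk> \<Longrightarrow> size X < size Y"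
    and size_epic: "\<lbrakk>e \<in> Hom C X Y; epic C e; \<not> iso_arrow C e\<rbrakk> \<Longrightarrow> size Y < size X"
begin

text \<open>The torsion part of \<open>M\<close> is a subobject in \<open>U\<close> whose cokernel has minimal size.\<close>

lemma torsion_decomposition:
  assumes U: "U \<in> tors C" and M: "M \<in> Obj C"
  obtains A N i p where "short_exact C i p" "i \<in> Hom C A M" "p \<in> Hom C M N" "A \<in> U"
    "N \<in> right_perp C U"
proof -
  define P where "P n \<longleftrightarrow> (\<exists>A N i p. short_exact C i p \<and> i \<in> Hom C A M \<and> p \<in> Hom C M N \<and> A \<in> U
    \<and> size N = n)" for n
  have "\<exists>n. P n"
  proof -
    obtain Z where Z: "zero_object C Z" using zero_object_ex by blast
    then have m: "ZeroArr C Z M \<in> Hom C Z M" using zero_Hom M by (simp add: zero_object_def)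
    obtain Q c where "short_exact C (ZeroArr C Z M) c" "c \<in> Hom C M Q"
      using short_exact_of_monic[OF monic_from_zero[OF Z m] m] .
    then show ?thesis unfolding P_def using m tors_zero[OF U Z] by blast
  qed
  then have least: "P (LEAST n. P n)" by (rule LeastI_ex)
  then obtain A N i p where ex: "short_exact C i p" and i: "i \<in> Hom C A M"
      and p: "p \<in> Hom C M N" and A: "A \<in> U" and N: "size N = (LEAST n. P n)"
    unfolding P_def[of "LEAST n. P n"] by metis
  note ip = short_exact_HomD[OF ex i p]
  have "f = ZeroArr C X N" if X: "X \<in> U" and f: "f \<in> Hom C X N" for X f
  proof (rule ccontr)
    assume f0: "f \<noteq> ZeroArr C X N"
    \<comment> \<open>A nonzero arrow from \<open>U\<close> to \<open>N\<close> would enlarge the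
      torsion part: the preimage \<open>K\<close> of its image is an extension of two objects of
      \<open>U\<close>, and the cokernel \<open>N'\<close> of \<open>K\<close> is a quotient of
      \<open>N\<close> that kills the image, hence strictly smaller than \<open>N\<close>.\<close>
    obtain I a m where am: "a \<in> Hom C X I" "epic C a" "m \<in> Hom C I N" "monic C m" "f = m \<cdot> a"
      using image_factorization[OF f] .
    obtain K k j q where k: "k \<in> Hom C K M" "monic C k" "j \<in> Hom C A K" "q \<in> Hom C K I"
        "short_exact C j q" "k \<cdot> j = i" "p \<cdot> k = m \<cdot> q"
      using preimage[OF ex i p am(3,4)] .
    have "K \<in> U" using tors_ext[OF U k(5,3,4) A] tors_factor[OF U X am(1,2)] .
    obtain N' d where d: "short_exact C k d" "d \<in> Hom C M N'" "epic C d" "d \<cdot> k = ZeroArr C K N'"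
      using short_exact_of_monic[OF k(2,1)] .
    then have "P (size N')" unfolding P_def using \<open>K \<in> U\<close> k(1) by blast
    then have le: "size N \<le> size N'" unfolding N by (rule Least_le)
    have "d \<cdot> i = ZeroArr C A N'" using zero_comp_right[OF d(4) k(1) d(2) k(3)] k(6) by simp
    then obtain s where s: "s \<in> Hom C N N'" "s \<cdot> p = d"
      using cokernel_lift[OF ip(5) i p d(2)] by blast
    have se: "epic C s" using epic_left_factor[OF _ p s(1)] s(2) d(3) by simp
    have sm: "s \<cdot> m \<in> Hom C I N'" using Comp_Hom[OF am(3) s(1)] .
    have "(s \<cdot> m) \<cdot> q = d \<cdot> k"
      using Comp_assoc[OF k(4) am(3) s(1)] Comp_assoc[OF k(1) p s(1)] s(2) k(7) by simp
    then have sm0: "s \<cdot> m = ZeroArr C I N'"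
      using epicD[OF short_exact_HomD(2)[OF k(5,3,4)] k(4) sm] d(4) by simp
    have "\<not> iso_arrow C s"
    proof
      assume "iso_arrow C s"
      then have "m = ZeroArr C I N" using monicD[OF iso_arrow_monic s(1) am(3) sm0] by simp
      then show False using f0 am(5) comp_zero_left[OF am(1)] Hom_Obj[OF p] by simp
    qed
    then show False using size_epic[OF s(1) se] le by simp
  qed
  moreover have "U \<subseteq> Obj C" using tors_Obj[OF U] by blast
  ultimately have "N \<in> right_perp C U" using right_perp_iff Hom_Obj[OF p] by blast
  then show thesis using that ex i p A by blast
qed

text \<open>Take the torsion-free quotient of an object of \<open>T\<close> outside
  \<open>U\<close>; if it were zero, the object would be isomorphic to its torsion part and lie in
  \<open>U\<close>.\<close>

lemma nonzero_torsion_free: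
  assumes U: "U \<in> tors C" and T: "T \<in> tors C" and "U \<subset> T"
  obtains N where "N \<in> right_perp C U \<inter> T" "\<not> zero_object C N"
proof -
  obtain M where M: "M \<in> T" "M \<notin> U" using assms by blast
  obtain A N i p where d: "short_exact C i p" "i \<in> Hom C A M" "p \<in> Hom C M N" "A \<in> U"
      "N \<in> right_perp C U"
    using torsion_decomposition[OF U tors_Obj[OF T M(1)]] .
  have "N \<in> T" using tors_factor[OF T M(1) d(3) short_exact_HomD(2)[OF d(1-3)]] .
  moreover have "\<not> zero_object C N"
    using iso_if_zero_cokernel[OF d(1-3)] iso_arrow_epic tors_factor[OF U d(4,2)] M(2) by blast
  ultimately show thesis using that d(5) by blast
qed

text \<open>
  A nonzero object \<open>B\<close> of minimal size in \<open>U\<^sup>\<bottom> \<inter> T\<close> is a brick.  If \<open>B'\<close> is another brick there, then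
  the objects without nonzero arrows to \<open>B'\<close> form a torsion class containing \<open>U\<close> but not \<open>T\<close>; by
  maximality it misses \<open>B\<close>.  So there are nonzero arrows \<open>B \<rightarrow> B'\<close>, and likewise \<open>B' \<rightarrow> B\<close>.
\<close>

lemma hasse_arrow_brick_label:
  assumes h: "hasse_arrow (tors C) T U"
  obtains B where "B \<in> right_perp C U \<inter> T" "brick C B" "brick_label C T U (iso_class C B)"
proof -
  have U: "U \<in> tors C" and T: "T \<in> tors C" and UT: "U \<subset> T"
    and max: "\<And>V. V \<in> tors C \<Longrightarrow> U \<subset> V \<Longrightarrow> \<not> V \<subset> T"
    using h by (auto simp: hasse_arrow_def)
  have UO: "U \<subseteq> Obj C" using tors_Obj[OF U] by blast
  define H where "H = right_perp C U \<inter> T"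
  have image_H: "I \<in> H" if "X \<in> H" "Y \<in> H" "a \<in> Hom C X I" "epic C a" "m \<in> Hom C I Y" "monic C m"
    for X Y I a m
    using that right_perp_sub[OF UO _ that(5,6)] tors_factor[OF T _ that(3,4)]
    by (auto simp: H_def)
  obtain N where N: "N \<in> H" "\<not> zero_object C N"
    using nonzero_torsion_free[OF U T UT] unfolding H_def by blast
  obtain B where B: "B \<in> H" "\<not> zero_object C B"
    and minB: "\<And>X. X \<in> H \<Longrightarrow> \<not> zero_object C X \<Longrightarrow> size B \<le> size X"
    using ex_has_least_nat[of "\<lambda>X. X \<in> H \<and> \<not> zero_object C X" N size] N by metis
  have BO: "B \<in> Obj C" using B tors_Obj[OF T] by (auto simp: H_def)
  have nonzero_image: "\<not> zero_object C I"
    if "f \<noteq> ZeroArr C X Y" "a \<in> Hom C X I" "m \<in> Hom C I Y" "f = m \<cdot> a" for X Y I f a m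
  proof
    assume "zero_object C I"
    then have "a = ZeroArr C X I" using Hom_to_zero that by blast
    then show False using that comp_zero_right[OF that(3)] Hom_Obj[OF that(2)] by simp
  qed
  \<comment> \<open>The image of a nonzero arrow between objects of \<open>H\<close> is a nonzero
    object of \<open>H\<close>, so it cannot be smaller than \<open>B\<close>; the epic onto it is
    then invertible. The same reasoning on the other factor makes arrows into \<open>B\<close>
    epic.\<close>
  have monic_from_B: "monic C f" if X: "X \<in> H" and f: "f \<in> Hom C B X" "f \<noteq> ZeroArr C B X" for X f
  proof -
    obtain I a m where am: "a \<in> Hom C B I" "epic C a" "m \<in> Hom C I X" "monic C m" "f = m \<cdot> a"
      using image_factorization[OF f(1)] .
    have "size B \<le> size I"
      using minB image_H[OF B(1) X am(1-4)] nonzero_image[OF f(2) am(1,3,5)] by blast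
    then have "iso_arrow C a" using size_epic[OF am(1,2)] by auto
    then show ?thesis using monic_comp[OF iso_arrow_monic am(4) am(1,3)] am(5) by blast
  qed
  have epic_to_B: "epic C f" if X: "X \<in> H" and f: "f \<in> Hom C X B" "f \<noteq> ZeroArr C X B" for X f
  proof -
    obtain I a m where am: "a \<in> Hom C X I" "epic C a" "m \<in> Hom C I B" "monic C m" "f = m \<cdot> a"
      using image_factorization[OF f(1)] .
    have "size B \<le> size I"
      using minB image_H[OF X B(1) am(1-4)] nonzero_image[OF f(2) am(1,3,5)] by blast
    then have "iso_arrow C m" using size_monic[OF am(3,4)] by auto
    then show ?thesis using epic_comp[OF am(2) iso_arrow_epic am(1,3)] am(5) by blast
  qed
  have brickB: "brick C B"
    using brick_iff BO B monic_from_B epic_to_B monic_epic_iso by blast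
  have hom_ex: "\<exists>f \<in> Hom C X Y. f \<noteq> ZeroArr C X Y"
    if X: "X \<in> H" "\<not> zero_object C X" and Y: "Y \<in> H" "\<not> zero_object C Y" for X Y
  proof (rule ccontr)
    assume no: "\<not> (\<exists>f \<in> Hom C X Y. f \<noteq> ZeroArr C X Y)"
    have XO: "X \<in> Obj C" and YO: "Y \<in> Obj C" using X Y tors_Obj[OF T] by (auto simp: H_def)
    define L where "L = {X \<in> Obj C. Hom C X Y = {ZeroArr C X Y}}"
    have "L \<in> tors C" unfolding L_def using tors_left_perp[OF YO] .
    then have LT: "L \<inter> T \<in> tors C" using tors_Inter[of "{L, T}"] T by simp
    have XL: "X \<in> L" using no XO YO zero_Hom by (auto simp: L_def)
    have "Y \<notin> L"
      using Y YO Ident_Hom[OF YO] unfolding L_def zero_object_iff by auto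
    have "U \<subseteq> L" using Y(1) UO by (auto simp: L_def H_def right_perp_def)
    moreover have "X \<notin> U" using X right_perp_meet_zero[OF UO] by (auto simp: H_def)
    ultimately have "U \<subset> L \<inter> T" using XL X UT by (auto simp: H_def)
    moreover have "L \<inter> T \<subset> T" using \<open>Y \<notin> L\<close> Y by (auto simp: H_def)
    ultimately show False using max[OF LT] by blast
  qed
  have "iso_class C B' = iso_class C B" if B': "B' \<in> H" "brick C B'" for B'
  proof -
    have B'0: "\<not> zero_object C B'" using B' brick_iff by blast
    obtain f where f: "f \<in> Hom C B B'" "f \<noteq> ZeroArr C B B'" using hom_ex B B'(1) B'0 by blast
    obtain g where g: "g \<in> Hom C B' B" "g \<noteq> ZeroArr C B' B" using hom_ex B B'(1) B'0 by blast
    have fm: "monic C f" and ge: "epic C g"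
      using monic_from_B[OF B'(1) f] epic_to_B[OF B'(1) g] by auto
    \<comment> \<open>The composite endomorphism of \<open>B'\<close> is nonzero because
      \<open>g\<close> is epic and \<open>f\<close> is not zero. As \<open>B'\<close> is a brick it
      is invertible, which makes the monic \<open>f\<close> epic as well.\<close>
    have fg: "f \<cdot> g \<in> Hom C B' B'" using Comp_Hom[OF g(1) f(1)] .
    moreover have "f \<cdot> g \<noteq> ZeroArr C B' B'" using epicD[OF ge g(1) f(1)] f(2) by blast
    ultimately have "iso_arrow C (f \<cdot> g)" using B'(2) brick_iff by blast
    then have "epic C f" using epic_left_factor[OF iso_arrow_epic g(1) f(1)] by blast
    then have "isomorphic C B B'" using monic_epic_iso[OF fm _ f(1)] isomorphicI[OF f(1)] by blast
    then show ?thesis using iso_class_eq by blast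
  qed
  then have "iso_class C ` {B \<in> right_perp C U \<inter> T. brick C B} = {iso_class C B}"
    using B(1) brickB unfolding H_def by blast
  then show thesis using that[OF _ brickB] h B(1) by (simp add: brick_label_def H_def)
qed

section \<open>Simple objects as labels at the top and the bottom of the lattice\<close>

lemma brick_label_eq:
  assumes "brick_label C T U L" "B \<in> right_perp C U \<inter> T" "brick C B"
  shows "L = iso_class C B"
  using assms unfolding brick_label_def by blast

lemma brick_labelI:
  assumes h: "hasse_arrow (tors C) T U" and B: "B \<in> right_perp C U \<inter> T" "brick C B"
  shows "brick_label C T U (iso_class C B)"
  using hasse_arrow_brick_label[OF h] brick_label_eq[OF _ B] by metis

text \<open>Any object outside the left perpendicular class \<open>X\<close> of a simple
  \<open>S\<close> maps onto \<open>S\<close>. A larger torsion class therefore contains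
  \<open>S\<close>, and then everything: removing quotients isomorphic to \<open>S\<close> one at a
  time ends in \<open>X\<close>. Conversely, an object \<open>M\<close> of minimal size outside
  \<open>V\<close> is simple, since a proper nonzero subobject and its quotient would both lie in
  \<open>V\<close> and so would \<open>M\<close>. Being simple and outside \<open>V\<close>, it
  receives no nonzero arrow from \<open>V\<close>, so it carries the label.\<close>

lemma sim_eq_labels_from_top:
  "sim C = {L. \<exists>V. brick_label C (Obj C) V L}"
proof (intro Set.set_eqI iffI)
  fix L assume "L \<in> sim C"
  then obtain S where S: "simple_object C S" and L: "L = iso_class C S" by (auto simp: sim_def)
  have SO: "S \<in> Obj C" using S by (simp add: simple_object_def)
  define X where "X = {Y \<in> Obj C. Hom C Y S = {ZeroArr C Y S}}"
  have X: "X \<in> tors C" unfolding X_def using tors_left_perp[OF SO] .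
  have "S \<notin> X"
    using S Ident_Hom[OF SO] unfolding X_def simple_object_def zero_object_iff by auto
  have top: "Z = Obj C" if Z: "Z \<in> tors C" "X \<subset> Z" for Z
  proof -
    have quot: "M \<in> X \<or> (\<exists>e \<in> Hom C M S. epic C e)" if "M \<in> Obj C" for M
      using that simple_object_epic[OF S] zero_Hom[OF that SO] unfolding X_def by blast
    obtain Y where "Y \<in> Z" "Y \<notin> X" using Z by blast
    then have SZ: "S \<in> Z" using quot tors_Obj[OF Z(1)] tors_factor[OF Z(1)] by metis
    have "M \<in> Z" if "M \<in> Obj C" for M
      using that
    proof (induction "size M" arbitrary: M rule: less_induct)
      case less
      show ?case
      proof (cases "M \<in> X")
        case True
        then show ?thesis using Z by blast
      next
        case False
        then obtain e where e: "e \<in> Hom C M S" "epic C e" using quot less.prems by blast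
        obtain K k where k: "short_exact C k e" "k \<in> Hom C K M" "monic C k"
            "e \<cdot> k = ZeroArr C K S"
          using short_exact_of_epic[OF e(2,1)] .
        have "\<not> iso_arrow C k"
          using epicD[OF iso_arrow_epic k(2) e(1) k(4)] zero_epic[OF e(2,1)] S
          by (auto simp: simple_object_def)
        then have "K \<in> Z" using less.hyps size_monic[OF k(2,3)] Hom_Obj[OF k(2)] by blast
        then show ?thesis using tors_ext[OF Z(1) k(1,2) e(1)] SZ by blast
      qed
    qed
    then show ?thesis using tors_Obj[OF Z(1)] by blast
  qed
  have "X \<subset> Obj C" using \<open>S \<notin> X\<close> SO tors_Obj[OF X] by blast
  then have h: "hasse_arrow (tors C) (Obj C) X"
    using X tors_Obj_mem top unfolding hasse_arrow_def by blast
  have "S \<in> right_perp C X \<inter> Obj C" using SO by (auto simp: right_perp_def X_def)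
  then show "L \<in> {L. \<exists>V. brick_label C (Obj C) V L}"
    using brick_labelI[OF h] simple_object_brick[OF S] L by blast
next
  fix L assume "L \<in> {L. \<exists>V. brick_label C (Obj C) V L}"
  then obtain V where lab: "brick_label C (Obj C) V L" by blast
  then have V: "V \<in> tors C" "V \<subset> Obj C" by (auto simp: brick_label_def hasse_arrow_def)
  then obtain N where N: "N \<in> Obj C" "N \<notin> V" by blast
  obtain M where M: "M \<in> Obj C" "M \<notin> V"
    and minM: "\<And>X. X \<in> Obj C \<Longrightarrow> X \<notin> V \<Longrightarrow> size M \<le> size X"
    using ex_has_least_nat[of "\<lambda>X. X \<in> Obj C \<and> X \<notin> V" N size] N by metis
  have "simple_object C M"
    unfolding simple_object_def
  proof (intro conjI allI impI)
    show "M \<in> Obj C" by (fact M(1))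
    show "\<not> zero_object C M" using M tors_zero[OF V(1)] by blast
    fix f assume f: "monic C f \<and> Cod C f = M"
    define X where "X = Dom C f"
    have fH: "f \<in> Hom C X M" using f by (auto simp: monic_def Hom_def X_def)
    obtain Q c where c: "short_exact C f c" "c \<in> Hom C M Q" "epic C c" "c \<cdot> f = ZeroArr C X Q"
      using short_exact_of_monic[OF _ fH] f by blast
    show "zero_object C (Dom C f) \<or> iso_arrow C f"
    proof (rule ccontr)
      assume no: "\<not> ?thesis"
      then have "X \<in> V"
        using minM[of X] size_monic[OF fH] f Hom_Obj[OF fH] by fastforce
      moreover have "\<not> iso_arrow C c"
        using monicD[OF iso_arrow_monic c(2) fH c(4)] zero_monic[OF _ fH] f no
        unfolding X_def by blast
      then have "Q \<in> V" using minM[of Q] size_epic[OF c(2,3)] Hom_Obj[OF c(2)] by fastforce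
      ultimately show False using tors_ext[OF V(1) c(1) fH c(2)] M(2) by blast
    qed
  qed
  moreover have "M \<in> right_perp C V \<inter> Obj C"
    using V M right_perp_iff simple_object_epic[OF \<open>simple_object C M\<close>] tors_factor[OF V(1)]
    by blast
  ultimately have "L = iso_class C M" using brick_label_eq[OF lab] simple_object_brick by blast
  then show "L \<in> sim C" using \<open>simple_object C M\<close> by (auto simp: sim_def)
qed

text \<open>If \<open>M\<close> is not simple, some nonzero proper subobject has a cokernel that is
  nonzero and smaller than \<open>M\<close>, and a simple quotient of that cokernel is one of
  \<open>M\<close>.\<close>

lemma simple_quotient_ex:
  assumes "M \<in> Obj C" "\<not> zero_object C M"
  obtains S e where "simple_object C S" "e \<in> Hom C M S" "epic C e"
proof -
  have "\<exists>S. simple_object C S \<and> (\<exists>e \<in> Hom C M S. epic C e)"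
    using assms
  proof (induction "size M" arbitrary: M rule: less_induct)
    case less
    show ?case
    proof (cases "simple_object C M")
      case True
      then show ?thesis
        using Ident_Hom[OF less.prems(1)] iso_arrow_epic[OF iso_arrow_Ident[OF less.prems(1)]]
        by blast
    next
      case False
      then obtain f where f: "monic C f" "Cod C f = M" "\<not> zero_object C (Dom C f)"
          "\<not> iso_arrow C f"
        using less.prems unfolding simple_object_def by blast
      define X where "X = Dom C f"
      have fH: "f \<in> Hom C X M" using f by (auto simp: monic_def Hom_def X_def)
      obtain Q c where c: "short_exact C f c" "c \<in> Hom C M Q" "epic C c" "c \<cdot> f = ZeroArr C X Q"
        using short_exact_of_monic[OF f(1) fH] .
      have "\<not> zero_object C Q" using iso_if_zero_cokernel[OF c(1) fH c(2)] f(4) by blast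
      moreover have "\<not> iso_arrow C c"
        using monicD[OF iso_arrow_monic c(2) fH c(4)] zero_monic[OF f(1) fH] f(3)
        unfolding X_def by blast
      ultimately obtain S e where "simple_object C S" "e \<in> Hom C Q S" "epic C e"
        using less.hyps[OF size_epic[OF c(2,3)]] Hom_Obj[OF c(2)] by blast
      then show ?thesis using Comp_Hom[OF c(2)] epic_comp[OF c(3) _ c(2)] by blast
    qed
  qed
  then show thesis using that by blast
qed

text \<open>
  The class \<open>F\<close> below is a torsion class, so it contains the one generated by \<open>S\<close>; hence every
  nonzero object of the latter has \<open>S\<close> as a quotient.
\<close>

lemma sim_eq_labels_to_bottom:
  "sim C = {L. \<exists>V. brick_label C V {Z. zero_object C Z} L}"
proof (intro Set.set_eqI iffI)
  fix L assume "L \<in> sim C"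
  then obtain S where S: "simple_object C S" and L: "L = iso_class C S" by (auto simp: sim_def)
  have SO: "S \<in> Obj C" and S0: "\<not> zero_object C S" using S by (auto simp: simple_object_def)
  define F where "F = {M \<in> Obj C. \<forall>N. \<forall>e \<in> Hom C M N. epic C e \<longrightarrow> zero_object C N \<or>
    (\<exists>f \<in> Hom C N S. f \<noteq> ZeroArr C N S)}"
  have F: "F \<in> tors C"
  proof (rule torsI)
    show "F \<subseteq> Obj C" by (auto simp: F_def)
    obtain Z where Z: "zero_object C Z" using zero_object_ex by blast
    then have "Z \<in> Obj C" by (simp add: zero_object_def)
    then have "Z \<in> F" using zero_object_quotient[OF Z] unfolding F_def by blast
    then show "F \<noteq> {}" by blast
  next
    fix X Y e assume X: "X \<in> F" and e: "e \<in> Hom C X Y" "epic C e"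
    show "Y \<in> F"
      using X Hom_Obj[OF e(1)] Comp_Hom[OF e(1)] epic_comp[OF e(2) _ e(1)] unfolding F_def by blast
  next
    fix A B Q i p
    assume ex: "short_exact C i p" and i: "i \<in> Hom C A B" and p: "p \<in> Hom C B Q"
      and A: "A \<in> F" and Q: "Q \<in> F"
    have "zero_object C N \<or> (\<exists>f \<in> Hom C N S. f \<noteq> ZeroArr C N S)"
      if e: "e \<in> Hom C B N" "epic C e" for N e
    proof -
      obtain I R a b c r where *: "a \<in> Hom C A I" "epic C a" "b \<in> Hom C I N" "c \<in> Hom C N R"
          "short_exact C b c" "r \<in> Hom C Q R" "epic C r"
        using extension_quotient[OF ex i p e] .
      \<comment> \<open>When \<open>R\<close> is zero, \<open>N\<close> is already a quotient of
        \<open>A\<close> and the condition on \<open>A\<close> applies. Otherwise a nonzero arrow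
        from \<open>R\<close> to \<open>S\<close> stays nonzero after composing with the epic
        \<open>c\<close>.\<close>
      show ?thesis
      proof (cases "zero_object C R")
        case True
        then have "iso_arrow C b" using iso_if_zero_cokernel[OF *(5,3,4)] by blast
        then have "epic C (b \<cdot> a)" using epic_comp[OF *(2) iso_arrow_epic *(1,3)] by blast
        then show ?thesis using A Comp_Hom[OF *(1,3)] unfolding F_def by blast
      next
        case False
        then obtain f where f: "f \<in> Hom C R S" "f \<noteq> ZeroArr C R S"
          using Q *(6,7) unfolding F_def by blast
        have "f \<cdot> c \<noteq> ZeroArr C N S"
          using epicD[OF short_exact_HomD(2)[OF *(5,3,4)] *(4) f(1)] f(2) by blast
        then show ?thesis using Comp_Hom[OF *(4) f(1)] by blast
      qed
    qed
    then show "B \<in> F" using Hom_Obj[OF i] unfolding F_def by blast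
  qed
  have "S \<in> F"
  proof -
    have "zero_object C N \<or> (\<exists>f \<in> Hom C N S. f \<noteq> ZeroArr C N S)"
      if e: "e \<in> Hom C S N" "epic C e" for N e
    proof (cases "zero_object C N")
      case False
      then have "monic C e" using simple_object_monic[OF S e(1)] zero_epic[OF e(2,1)] by blast
      then obtain g where g: "g \<in> Hom C N S" "g \<cdot> e = Ident C S"
        using iso_arrowE[OF monic_epic_iso[OF _ e(2,1)] e(1)] by blast
      then have "g \<noteq> ZeroArr C N S"
        using comp_zero_left[OF e(1) SO] S0 SO by (auto simp: zero_object_iff)
      then show ?thesis using g by blast
    qed simp
    then show ?thesis using SO by (auto simp: F_def)
  qed
  define X where "X = \<Inter>{V \<in> tors C. S \<in> V}"
  have X: "X \<in> tors C" unfolding X_def using tors_Inter[of "{V \<in> tors C. S \<in> V}"] F \<open>S \<in> F\<close> by blast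
  have "S \<in> X" by (simp add: X_def)
  have "X \<subseteq> F" unfolding X_def using F \<open>S \<in> F\<close> by blast
  have bot: "Z = X" if Z: "Z \<in> tors C" "Z \<subseteq> X" "{Z. zero_object C Z} \<subset> Z" for Z
  proof -
    obtain M where M: "M \<in> Z" "\<not> zero_object C M" using Z(3) by blast
    have MO: "M \<in> Obj C" using tors_Obj[OF Z(1) M(1)] .
    have "M \<in> F" using M(1) Z(2) \<open>X \<subseteq> F\<close> by blast
    then obtain f where f: "f \<in> Hom C M S" "f \<noteq> ZeroArr C M S"
      using M(2) Ident_Hom[OF MO] iso_arrow_epic[OF iso_arrow_Ident[OF MO]] unfolding F_def by blast
    then have "S \<in> Z" using tors_factor[OF Z(1) M(1) f(1)] simple_object_epic[OF S] by blast
    then have "X \<subseteq> Z" unfolding X_def using Z(1) by blast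
    then show ?thesis using Z(2) by blast
  qed
  have "{Z. zero_object C Z} \<subset> X" using tors_zero[OF X] \<open>S \<in> X\<close> S0 by blast
  then have h: "hasse_arrow (tors C) X {Z. zero_object C Z}"
    using X tors_zero_objects bot unfolding hasse_arrow_def by blast
  have "S \<in> right_perp C {Z. zero_object C Z}"
    using right_perp_iff[of "{Z. zero_object C Z}"] SO Hom_from_zero by (auto simp: zero_object_def)
  then show "L \<in> {L. \<exists>V. brick_label C V {Z. zero_object C Z} L}"
    using brick_labelI[OF h] \<open>S \<in> X\<close> simple_object_brick[OF S] L by blast
next
  fix L assume "L \<in> {L. \<exists>V. brick_label C V {Z. zero_object C Z} L}"
  then obtain V where lab: "brick_label C V {Z. zero_object C Z} L" by blast
  then have V: "V \<in> tors C" "{Z. zero_object C Z} \<subset> V"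
    by (auto simp: brick_label_def hasse_arrow_def)
  then obtain M where M: "M \<in> V" "\<not> zero_object C M" by blast
  obtain S e where S: "simple_object C S" "e \<in> Hom C M S" "epic C e"
    using simple_quotient_ex[OF tors_Obj[OF V(1) M(1)] M(2)] .
  have "S \<in> V" using tors_factor[OF V(1) M(1) S(2,3)] .
  moreover have "S \<in> right_perp C {Z. zero_object C Z}"
    using right_perp_iff[of "{Z. zero_object C Z}"] Hom_Obj[OF S(2)] Hom_from_zero
    by (auto simp: zero_object_def)
  ultimately have "L = iso_class C S"
    using brick_label_eq[OF lab] simple_object_brick[OF S(1)] by blast
  then show "L \<in> sim C" using S(1) by (auto simp: sim_def)
qed

end

section \<open>Composition series\<close>

context preadditive_exact_category
begin

text \<open>The inductive form exposes the top factor \<open>S\<close> of a composition series, so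
  that rule induction can compare a subobject or a quotient of \<open>Y\<close> with
  \<open>X\<close> and \<open>S\<close> separately.\<close>

inductive series :: "nat \<Rightarrow> 'o \<Rightarrow> bool" where
  series_zero: "zero_object C X \<Longrightarrow> series 0 X"
| series_Suc: "\<lbrakk>series n X; short_exact C i p; i \<in> Hom C X Y; p \<in> Hom C Y S; simple_object C S\<rbrakk>
    \<Longrightarrow> series (Suc n) Y"

lemma has_composition_series_series:
  assumes "has_composition_series C X"
  shows "\<exists>n. series n X"
proof -
  obtain n F where F: "zero_object C (F 0)" "F n = X" and
    step: "\<And>i. i < n \<Longrightarrow> \<exists>f g. short_exact C f g \<and> Dom C f = F i \<and> Cod C f = F (Suc i) \<and>
        simple_object C (Cod C g)"
    using assms unfolding has_composition_series_def by blast
  have "series k (F k)" if "k \<le> n" for k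
    using that
  proof (induction k)
    case 0
    show ?case using series_zero F(1) .
  next
    case (Suc k)
    obtain f g where fg: "short_exact C f g" "Dom C f = F k" "Cod C f = F (Suc k)"
        "simple_object C (Cod C g)"
      using step[of k] Suc.prems by auto
    have "f \<in> Hom C (F k) (F (Suc k))" "g \<in> Hom C (F (Suc k)) (Cod C g)"
      using short_exactD(1,2)[OF fg(1)] fg(2,3) by auto
    then show ?case using series_Suc[OF _ fg(1)] fg(4) Suc by simp
  qed
  then show ?thesis using F(2) by blast
qed

text \<open>Either \<open>Y\<close> lies inside the first term \<open>X\<close>, which saves a step,
  or it maps onto the top factor \<open>S\<close> and its intersection \<open>K\<close> with
  \<open>X\<close> is handled by induction. Recording that equal length forces \<open>m\<close> to
  be invertible is what later makes the size strictly decreasing.\<close>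

lemma series_sub:
  assumes "series n X" "m \<in> Hom C Y X" "monic C m"
  shows "\<exists>k\<le>n. series k Y \<and> (k = n \<longrightarrow> iso_arrow C m)"
  using assms
proof (induction arbitrary: Y m rule: series.induct)
  case (series_zero X)
  have "zero_object C Y" using zero_object_sub[OF series_zero] .
  moreover have "iso_arrow C m"
    using monic_epic_iso[OF series_zero(3) epic_to_zero[OF series_zero(1,2)] series_zero(2)] .
  ultimately show ?case using series.series_zero by blast
next
  case (series_Suc n X i p Z S)
  note m = series_Suc.prems
  note i = series_Suc.hyps(3) and p = series_Suc.hyps(4) and S = series_Suc.hyps(5)
  note ip = short_exact_HomD[OF series_Suc.hyps(2) i p]
  have pm: "p \<cdot> m \<in> Hom C Y S" using Comp_Hom[OF m(1) p] .
  show ?case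
  proof (cases "p \<cdot> m = ZeroArr C Y S")
    case True
    then obtain u where u: "u \<in> Hom C Y X" "i \<cdot> u = m"
      using kernel_lift[OF ip(4) p i m(1)] by blast
    then have "monic C u" using monic_right_factor[OF _ u(1) i] m(2) by simp
    then obtain k where "k \<le> n" "series k Y" using series_Suc.IH[OF u(1)] by blast
    then show ?thesis by (intro exI[of _ k]) auto
  next
    case False
    have e: "epic C (p \<cdot> m)" using simple_object_epic[OF S pm False] .
    obtain K k where k: "short_exact C k (p \<cdot> m)" "k \<in> Hom C K Y" "monic C k"
        "(p \<cdot> m) \<cdot> k = ZeroArr C K S"
      using short_exact_of_epic[OF e pm] .
    have mk: "m \<cdot> k \<in> Hom C K Z" using Comp_Hom[OF k(2) m(1)] .
    have "p \<cdot> (m \<cdot> k) = ZeroArr C K S" using Comp_assoc[OF k(2) m(1) p] k(4) by simp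
    then obtain u where u: "u \<in> Hom C K X" "i \<cdot> u = m \<cdot> k"
      using kernel_lift[OF ip(4) p i mk] by blast
    have "monic C (i \<cdot> u)" using u(2) monic_comp[OF k(3) m(2) k(2) m(1)] by simp
    then have "monic C u" using monic_right_factor[OF _ u(1) i] by simp
    then obtain l where l: "l \<le> n" "series l K" "l = n \<longrightarrow> iso_arrow C u"
      using series_Suc.IH[OF u(1)] by blast
    \<comment> \<open>Here \<open>K\<close> is all of \<open>X\<close>, and \<open>Y\<close> still
      maps onto \<open>S\<close>. An arrow killing \<open>Y\<close> then kills \<open>X\<close>,
      factors through \<open>S\<close> and vanishes there.\<close>
    have "iso_arrow C m" if "l = n"
    proof (rule monic_epic_iso[OF m(2) _ m(1)], rule epicI[OF m(1)])
      fix V h assume h: "h \<in> Hom C Z V" "h \<cdot> m = ZeroArr C Y V"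
      have "(h \<cdot> i) \<cdot> u = (h \<cdot> m) \<cdot> k"
        using Comp_assoc[OF u(1) i h(1)] Comp_assoc[OF k(2) m(1) h(1)] u(2) by simp
      then have "(h \<cdot> i) \<cdot> u = ZeroArr C K V"
        using h comp_zero_left[OF k(2)] Hom_Obj[OF h(1)] by simp
      then have "h \<cdot> i = ZeroArr C X V"
        using epicD[OF iso_arrow_epic u(1) Comp_Hom[OF i h(1)]] l(3) that by blast
      then obtain v where v: "v \<in> Hom C S V" "v \<cdot> p = h"
        using cokernel_lift[OF ip(5) i p h(1)] by blast
      have "v \<cdot> (p \<cdot> m) = ZeroArr C Y V" using v h(2) Comp_assoc[OF m(1) p v(1)] by simp
      then have "v = ZeroArr C S V" using epicD[OF e pm v(1)] by simp
      then show "h = ZeroArr C Z V" using v comp_zero_left[OF p] Hom_Obj[OF h(1)] by simp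
    qed
    then show ?thesis using series.series_Suc[OF l(2) k(1,2) pm S] l(1) by auto
  qed
qed

text \<open>Let \<open>I\<close> be the image of \<open>X\<close> in \<open>Y\<close>. The cokernel
  \<open>R\<close> of \<open>I\<close> is a quotient of the simple object \<open>S\<close>: if it is
  zero, \<open>Y\<close> is a quotient of \<open>X\<close> and a step is saved; otherwise it is
  isomorphic to \<open>S\<close> and extends a series of \<open>I\<close>.\<close>

lemma series_quotient:
  assumes "series n X" "e \<in> Hom C X Y" "epic C e"
  shows "\<exists>k\<le>n. series k Y \<and> (k = n \<longrightarrow> iso_arrow C e)"
  using assms
proof (induction arbitrary: Y e rule: series.induct)
  case (series_zero X)
  have "zero_object C Y" using zero_object_quotient[OF series_zero] .
  moreover have "iso_arrow C e"
    using monic_epic_iso[OF monic_from_zero[OF series_zero(1,2)] series_zero(3) series_zero(2)] .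
  ultimately show ?case using series.series_zero by blast
next
  case (series_Suc n X i p Z S)
  note e = series_Suc.prems
  note i = series_Suc.hyps(3) and p = series_Suc.hyps(4) and S = series_Suc.hyps(5)
  note ip = short_exact_HomD[OF series_Suc.hyps(2) i p]
  have ei: "e \<cdot> i \<in> Hom C X Y" using Comp_Hom[OF i e(1)] .
  obtain I a m where am: "a \<in> Hom C X I" "epic C a" "m \<in> Hom C I Y" "monic C m" "e \<cdot> i = m \<cdot> a"
    using image_factorization[OF ei] .
  obtain R c where c: "short_exact C m c" "c \<in> Hom C Y R" "epic C c" "c \<cdot> m = ZeroArr C I R"
    using short_exact_of_monic[OF am(4,3)] .
  have ce: "c \<cdot> e \<in> Hom C Z R" using Comp_Hom[OF e(1) c(2)] .
  have "(c \<cdot> e) \<cdot> i = (c \<cdot> m) \<cdot> a"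
    using Comp_assoc[OF i e(1) c(2)] am(5) Comp_assoc[OF am(1,3) c(2)] by simp
  then have "(c \<cdot> e) \<cdot> i = ZeroArr C X R"
    using c(4) comp_zero_left[OF am(1)] Hom_Obj[OF c(2)] by simp
  then obtain s where s: "s \<in> Hom C S R" "s \<cdot> p = c \<cdot> e"
    using cokernel_lift[OF ip(5) i p ce] by blast
  have "epic C (c \<cdot> e)" using epic_comp[OF e(2) c(3) e(1) c(2)] .
  then have se: "epic C s" using epic_left_factor[OF _ p s(1)] s(2) by simp
  show ?case
  proof (cases "s = ZeroArr C S R")
    case True
    then have "zero_object C R" using zero_epic[OF se s(1)] by simp
    then have "epic C m" using iso_if_zero_cokernel[OF c(1) am(3) c(2)] iso_arrow_epic by blast
    then have "epic C (e \<cdot> i)" using am(5) epic_comp[OF am(2) _ am(1,3)] by simp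
    then obtain k where "k \<le> n" "series k Y" using series_Suc.IH[OF ei] by blast
    then show ?thesis by (intro exI[of _ k]) auto
  next
    case False
    have sm: "monic C s" using simple_object_monic[OF S s(1) False] .
    then obtain t where t: "t \<in> Hom C R S" "t \<cdot> s = Ident C S" "s \<cdot> t = Ident C R"
      using iso_arrowE[OF monic_epic_iso[OF _ se s(1)] s(1)] by blast
    have tiso: "iso_arrow C t" using iso_arrowI[OF t(1) s(1) t(3,2)] .
    \<comment> \<open>Composing with the isomorphism \<open>t\<close> from \<open>R\<close> to
      \<open>S\<close> makes the top factor literally \<open>S\<close>, so simplicity need not be
      transported to \<open>R\<close>.\<close>
    have tc: "t \<cdot> c \<in> Hom C Y S" using Comp_Hom[OF c(2) t(1)] .
    have tce: "epic C (t \<cdot> c)" using epic_comp[OF c(3) iso_arrow_epic[OF tiso] c(2) t(1)] .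
    have ker: "is_kernel C m (t \<cdot> c)"
    proof (rule is_kernelI[OF am(3) tc am(4)])
      show "(t \<cdot> c) \<cdot> m = ZeroArr C I S" using zero_comp_left[OF c(4) am(3) c(2) t(1)] .
      fix W g assume g: "g \<in> Hom C W Y" "(t \<cdot> c) \<cdot> g = ZeroArr C W S"
      have "t \<cdot> (c \<cdot> g) = ZeroArr C W S" using g Comp_assoc[OF g(1) c(2) t(1)] by simp
      then have "c \<cdot> g = ZeroArr C W R"
        using monicD[OF iso_arrow_monic[OF tiso] t(1) Comp_Hom[OF g(1) c(2)]] by simp
      then show "\<exists>u \<in> Hom C W I. m \<cdot> u = g"
        using kernel_lift[OF short_exact_HomD(4)[OF c(1) am(3) c(2)] c(2) am(3) g(1)] by blast
    qed
    then have ex: "short_exact C m (t \<cdot> c)"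
      using epic_cokernel_of_kernel[OF tce tc] by (simp add: short_exact_def)
    obtain l where l: "l \<le> n" "series l I" "l = n \<longrightarrow> iso_arrow C a"
      using series_Suc.IH[OF am(1,2)] by blast
    have "iso_arrow C e" if "l = n"
    proof (rule monic_epic_iso[OF _ e(2) e(1)], rule monicI[OF e(1)])
      fix W g assume g: "g \<in> Hom C W Z" "e \<cdot> g = ZeroArr C W Y"
      have "s \<cdot> (p \<cdot> g) = c \<cdot> (e \<cdot> g)"
        using Comp_assoc[OF g(1) p s(1)] Comp_assoc[OF g(1) e(1) c(2)] s(2) by simp
      then have "s \<cdot> (p \<cdot> g) = ZeroArr C W R"
        using g comp_zero_right[OF c(2)] Hom_Obj[OF g(1)] by simp
      then have "p \<cdot> g = ZeroArr C W S" using monicD[OF sm s(1) Comp_Hom[OF g(1) p]] by simp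
      then obtain v where v: "v \<in> Hom C W X" "i \<cdot> v = g"
        using kernel_lift[OF ip(4) p i g(1)] by blast
      have "monic C (m \<cdot> a)"
        using monic_comp[OF iso_arrow_monic am(4) am(1,3)] l(3) that by blast
      moreover have "(m \<cdot> a) \<cdot> v = ZeroArr C W Y"
        using Comp_assoc[OF v(1) i e(1)] am(5) v(2) g(2) by simp
      ultimately have "v = ZeroArr C W X" using monicD[OF _ Comp_Hom[OF am(1,3)] v(1)] by simp
      then show "g = ZeroArr C W Z" using v comp_zero_right[OF i] Hom_Obj[OF g(1)] by simp
    qed
    then show ?thesis using series.series_Suc[OF l(2) ex am(3) tc S] l(1) by auto
  qed
qed

text \<open>The size is the length of a shortest series. Subobjects and quotients inherit series
  that are strictly shorter unless the arrow is invertible; this comparison takes the place of the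
  Jordan-Hoelder theorem.\<close>

lemma finite_length_sized:
  assumes "\<And>X. X \<in> Obj C \<Longrightarrow> has_composition_series C X"
  shows "sized_exact_category C (\<lambda>X. LEAST n. series n X)"
proof -
  have series: "series (LEAST n. series n X) X" if "X \<in> Obj C" for X
    using has_composition_series_series[OF assms[OF that]] by (rule LeastI_ex)
  show ?thesis
  proof unfold_locales
    fix m X Y assume m: "m \<in> Hom C X Y" "monic C m" "\<not> iso_arrow C m"
    obtain k where "k < (LEAST n. series n Y)" "series k X"
      using series_sub[OF series m(1,2)] Hom_Obj[OF m(1)] m(3) by (metis le_neq_implies_less)
    then show "(LEAST n. series n X) < (LEAST n. series n Y)" by (meson Least_le le_less_trans)
  next
    fix e X Y assume e: "e \<in> Hom C X Y" "epic C e" "\<not> iso_arrow C e"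
    obtain k where "k < (LEAST n. series n X)" "series k Y"
      using series_quotient[OF series e(1,2)] Hom_Obj[OF e(1)] e(3) by (metis le_neq_implies_less)
    then show "(LEAST n. series n Y) < (LEAST n. series n X)" by (meson Least_le le_less_trans)
  qed
qed

end


section \<open>Wide subcategories\<close>

lemma full_on_simps [simp]:
  "Obj (full_on C S) = S" "Dom (full_on C S) = Dom C" "Cod (full_on C S) = Cod C"
  "Comp (full_on C S) = Comp C" "Ident (full_on C S) = Ident C"
  "AddArr (full_on C S) = AddArr C" "ZeroArr (full_on C S) = ZeroArr C"
  by (simp_all add: full_on_def)

lemma full_on_Hom_iff: "f \<in> Hom (full_on C S) X Y \<longleftrightarrow> f \<in> Hom C X Y \<and> X \<in> S \<and> Y \<in> S"
  by (auto simp: full_on_def Hom_def)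

lemma full_on_Hom: "X \<in> S \<Longrightarrow> Y \<in> S \<Longrightarrow> Hom (full_on C S) X Y = Hom C X Y"
  by (auto simp: full_on_Hom_iff)

lemma full_on_Arr_Hom:
  assumes "f \<in> Arr (full_on C S)"
  shows "f \<in> Hom C (Dom C f) (Cod C f)" "Dom C f \<in> S" "Cod C f \<in> S"
  using assms by (auto simp: full_on_def Hom_def)

lemma (in preadditive_category) full_on_preadditive:
  assumes "S \<subseteq> Obj C"
  shows "preadditive_category (full_on C S)"
proof (intro preadditive_category.intro category.intro preadditive_category_axioms.intro)
  fix f assume "f \<in> Arr (full_on C S)"
  then show "Dom (full_on C S) f \<in> Obj (full_on C S)" "Cod (full_on C S) f \<in> Obj (full_on C S)"
    by (simp_all add: full_on_Arr_Hom)
next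
  fix X assume "X \<in> Obj (full_on C S)"
  then show "Ident (full_on C S) X \<in> Hom (full_on C S) X X"
    using assms Ident_Hom by (auto simp: full_on_Hom_iff)
next
  fix X Y assume "X \<in> Obj (full_on C S)" "Y \<in> Obj (full_on C S)"
  moreover from this have "Hom_group (full_on C S) X Y = Hom_group C X Y"
    by (simp add: Hom_group_def full_on_Hom)
  ultimately show "comm_group (Hom_group (full_on C S) X Y)"
    using Hom_comm_group assms by (simp add: subset_iff)
qed (auto simp: full_on_Hom_iff Comp_Hom Comp_assoc Comp_Ident_left Comp_Ident_right
    Comp_add_left Comp_add_right)

locale wide_exact_subcategory = sized_exact_category C size
  for C :: "('o, 'm, 'z) additive_cat_scheme" (structure) and size +
  fixes W :: "'o set"
  assumes wide: "wide_subcategory C W"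
begin

lemma wide_Obj: "X \<in> W \<Longrightarrow> X \<in> Obj C"
  using wide by (auto simp: wide_subcategory_def subcategory_def)

lemma wide_iso: "X \<in> W \<Longrightarrow> isomorphic C X Y \<Longrightarrow> Y \<in> W"
proof -
  assume "X \<in> W" "isomorphic C X Y"
  moreover from this have "Y \<in> Obj C" unfolding isomorphic_def using Hom_Obj by blast
  ultimately show "Y \<in> W" using wide by (auto simp: wide_subcategory_def subcategory_def)
qed

lemma wide_kernel: "is_kernel C k f \<Longrightarrow> k \<in> Hom C K X \<Longrightarrow> f \<in> Hom C X Y \<Longrightarrow> X \<in> W \<Longrightarrow> Y \<in> W \<Longrightarrow> K \<in> W"
  using wide HomD unfolding wide_subcategory_def closed_kernels_def by metis

lemma wide_cokernel:
  "is_cokernel C c f \<Longrightarrow> c \<in> Hom C Y Q \<Longrightarrow> f \<in> Hom C X Y \<Longrightarrow> X \<in> W \<Longrightarrow> Y \<in> W \<Longrightarrow> Q \<in> W"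
  using wide HomD unfolding wide_subcategory_def closed_cokernels_def by metis

lemma wide_ext:
  "short_exact C i p \<Longrightarrow> i \<in> Hom C A B \<Longrightarrow> p \<in> Hom C B Q \<Longrightarrow> A \<in> W \<Longrightarrow> Q \<in> W \<Longrightarrow> B \<in> W"
  using wide HomD unfolding wide_subcategory_def closed_extensions_def by metis

section \<open>Comparison of the full subcategory on \<open>W\<close> with the ambient
  category\<close>

abbreviation (input) D :: "('o, 'm, 'z) additive_cat_scheme" where
  "D \<equiv> full_on C W"

lemma preadditive_full: "preadditive_category D"
  using full_on_preadditive wide_Obj by blast

lemma zero_object_full: "zero_object D Z \<longleftrightarrow> zero_object C Z \<and> Z \<in> W"
  using preadditive_category.zero_object_iff[OF preadditive_full] zero_object_iff wide_Obj by auto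

text \<open>Being monic in \<open>D\<close> tests fewer arrows, but the kernel of \<open>f\<close>
  formed in \<open>C\<close> lies in \<open>W\<close> and is already among the tests.\<close>

lemma monic_full:
  assumes "f \<in> Hom D X Y"
  shows "monic D f \<longleftrightarrow> monic C f"
proof -
  interpret D: preadditive_category D by (fact preadditive_full)
  have f: "f \<in> Hom C X Y" "X \<in> W" "Y \<in> W" using assms by (auto simp: full_on_Hom_iff)
  show ?thesis
  proof
    assume m: "monic D f"
    obtain K k where k: "is_kernel C k f" "k \<in> Hom C K X" "monic C k" "f \<cdot> k = ZeroArr C K Y"
      using kernel_obtain[OF f(1)] .
    have K: "K \<in> W" using wide_kernel[OF k(1,2) f] .
    then have kD: "k \<in> Hom D K X" using k f by (simp add: full_on_Hom_iff)
    have k0: "k = ZeroArr C K X" using D.monicD[OF m assms kD] k(4) by simp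
    show "monic C f"
    proof (rule monicI[OF f(1)])
      fix V g assume g: "g \<in> Hom C V X" "f \<cdot> g = ZeroArr C V Y"
      obtain u where u: "u \<in> Hom C V K" "k \<cdot> u = g" using kernel_lift[OF k(1) f(1) k(2) g] .
      then show "g = ZeroArr C V X" using k0 comp_zero_left[OF u(1)] Hom_Obj[OF g(1)] by simp
    qed
  next
    assume m: "monic C f"
    show "monic D f"
    proof (rule D.monicI[OF assms])
      fix V g assume "g \<in> Hom D V X" "f \<cdot>\<^bsub>D\<^esub> g = ZeroArr D V Y"
      then show "g = ZeroArr D V X" using monicD[OF m f(1)] by (simp add: full_on_Hom_iff)
    qed
  qed
qed

lemma epic_full:
  assumes "f \<in> Hom D X Y"
  shows "epic D f \<longleftrightarrow> epic C f"
proof -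
  interpret D: preadditive_category D by (fact preadditive_full)
  have f: "f \<in> Hom C X Y" "X \<in> W" "Y \<in> W" using assms by (auto simp: full_on_Hom_iff)
  show ?thesis
  proof
    assume e: "epic D f"
    obtain Q c where c: "is_cokernel C c f" "c \<in> Hom C Y Q" "epic C c" "c \<cdot> f = ZeroArr C X Q"
      using cokernel_obtain[OF f(1)] .
    have Q: "Q \<in> W" using wide_cokernel[OF c(1,2) f] .
    then have cD: "c \<in> Hom D Y Q" using c f by (simp add: full_on_Hom_iff)
    have c0: "c = ZeroArr C Y Q" using D.epicD[OF e assms cD] c(4) by simp
    show "epic C f"
    proof (rule epicI[OF f(1)])
      fix V g assume g: "g \<in> Hom C Y V" "g \<cdot> f = ZeroArr C X V"
      obtain u where u: "u \<in> Hom C Q V" "u \<cdot> c = g" using cokernel_lift[OF c(1) f(1) c(2) g] .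
      then show "g = ZeroArr C Y V" using c0 comp_zero_right[OF u(1)] Hom_Obj[OF g(1)] by simp
    qed
  next
    assume e: "epic C f"
    show "epic D f"
    proof (rule D.epicI[OF assms])
      fix V g assume "g \<in> Hom D Y V" "g \<cdot>\<^bsub>D\<^esub> f = ZeroArr D X V"
      then show "g = ZeroArr D Y V" using epicD[OF e f(1)] by (simp add: full_on_Hom_iff)
    qed
  qed
qed

lemma iso_arrow_full:
  assumes "f \<in> Hom D X Y"
  shows "iso_arrow D f \<longleftrightarrow> iso_arrow C f"
  using assms by (auto simp: iso_arrow_def full_on_Hom_iff Hom_def full_on_def)

text \<open>Given a kernel in \<open>D\<close>, the kernel \<open>k'\<close> of \<open>f\<close>
  formed in \<open>C\<close> lies in \<open>W\<close> and so factors through it. An arrow from an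
  object outside \<open>W\<close> first lifts to \<open>k'\<close> and from there to
  \<open>k\<close>.\<close>

lemma is_kernel_full:
  assumes k: "k \<in> Hom D K X" and f: "f \<in> Hom D X Y"
  shows "is_kernel D k f \<longleftrightarrow> is_kernel C k f"
proof -
  interpret D: preadditive_category D by (fact preadditive_full)
  have fC: "f \<in> Hom C X Y" and kC: "k \<in> Hom C K X" and XY: "X \<in> W" "Y \<in> W"
    using k f by (auto simp: full_on_Hom_iff)
  show ?thesis
  proof
    assume ker: "is_kernel D k f"
    note kD = D.kernelD[OF ker f]
    obtain K' k' where k': "is_kernel C k' f" "k' \<in> Hom C K' X" "monic C k'"
        "f \<cdot> k' = ZeroArr C K' Y"
      using kernel_obtain[OF fC] .
    have "k' \<in> Hom D K' X" using k'(2) wide_kernel[OF k'(1,2) fC XY] XY by (simp add: full_on_Hom_iff)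
    then obtain u where u: "u \<in> Hom D K' K" "k \<cdot> u = k'"
      using D.kernel_lift[OF ker f k] k'(4) by auto
    show "is_kernel C k f"
    proof (rule is_kernelI[OF kC fC])
      show "monic C k" using kD(3) monic_full[OF k] by simp
      show "f \<cdot> k = ZeroArr C K Y" using kD(2) HomD[OF k] by simp
      fix V g assume g: "g \<in> Hom C V X" "f \<cdot> g = ZeroArr C V Y"
      obtain v where v: "v \<in> Hom C V K'" "k' \<cdot> v = g" using kernel_lift[OF k'(1) fC k'(2) g] .
      have uC: "u \<in> Hom C K' K" using u(1) by (simp add: full_on_Hom_iff)
      have "k \<cdot> (u \<cdot> v) = g" using Comp_assoc[OF v(1) uC kC] u(2) v(2) by simp
      then show "\<exists>w \<in> Hom C V K. k \<cdot> w = g" using Comp_Hom[OF v(1) uC] by blast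
    qed
  next
    assume ker: "is_kernel C k f"
    note kD = kernelD[OF ker fC]
    show "is_kernel D k f"
    proof (rule D.is_kernelI[OF k f])
      show "monic D k" using kD(3) monic_full[OF k] by simp
      show "f \<cdot>\<^bsub>D\<^esub> k = ZeroArr D K Y" using kD(2) HomD[OF kC] by simp
      fix V g assume g: "g \<in> Hom D V X" "f \<cdot>\<^bsub>D\<^esub> g = ZeroArr D V Y"
      then obtain w where "w \<in> Hom C V K" "k \<cdot> w = g"
        using kernel_lift[OF ker fC kC, of g V] by (auto simp: full_on_Hom_iff)
      then show "\<exists>w \<in> Hom D V K. k \<cdot>\<^bsub>D\<^esub> w = g"
        using g k by (intro bexI[of _ w]) (auto simp: full_on_Hom_iff)
    qed
  qed
qed

lemma is_cokernel_full:
  assumes c: "c \<in> Hom D Y Q" and f: "f \<in> Hom D X Y"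
  shows "is_cokernel D c f \<longleftrightarrow> is_cokernel C c f"
proof -
  interpret D: preadditive_category D by (fact preadditive_full)
  have fC: "f \<in> Hom C X Y" and cC: "c \<in> Hom C Y Q" and XY: "X \<in> W" "Y \<in> W"
    using c f by (auto simp: full_on_Hom_iff)
  show ?thesis
  proof
    assume coker: "is_cokernel D c f"
    note cD = D.cokernelD[OF coker f]
    obtain Q' c' where c': "is_cokernel C c' f" "c' \<in> Hom C Y Q'" "epic C c'"
        "c' \<cdot> f = ZeroArr C X Q'"
      using cokernel_obtain[OF fC] .
    have "c' \<in> Hom D Y Q'"
      using c'(2) wide_cokernel[OF c'(1,2) fC XY] XY by (simp add: full_on_Hom_iff)
    then obtain u where u: "u \<in> Hom D Q Q'" "u \<cdot> c = c'"
      using D.cokernel_lift[OF coker f c] c'(4) by auto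
    show "is_cokernel C c f"
    proof (rule is_cokernelI[OF cC fC])
      show "epic C c" using cD(3) epic_full[OF c] by simp
      show "c \<cdot> f = ZeroArr C X Q" using cD(2) HomD[OF c] by simp
      fix V g assume g: "g \<in> Hom C Y V" "g \<cdot> f = ZeroArr C X V"
      obtain v where v: "v \<in> Hom C Q' V" "v \<cdot> c' = g" using cokernel_lift[OF c'(1) fC c'(2) g] .
      have uC: "u \<in> Hom C Q Q'" using u(1) by (simp add: full_on_Hom_iff)
      have "(v \<cdot> u) \<cdot> c = g" using Comp_assoc[OF cC uC v(1)] u(2) v(2) by simp
      then show "\<exists>w \<in> Hom C Q V. w \<cdot> c = g" using Comp_Hom[OF uC v(1)] by blast
    qed
  next
    assume coker: "is_cokernel C c f"
    note cD = cokernelD[OF coker fC]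
    show "is_cokernel D c f"
    proof (rule D.is_cokernelI[OF c f])
      show "epic D c" using cD(3) epic_full[OF c] by simp
      show "c \<cdot>\<^bsub>D\<^esub> f = ZeroArr D X Q" using cD(2) HomD[OF cC] by simp
      fix V g assume g: "g \<in> Hom D Y V" "g \<cdot>\<^bsub>D\<^esub> f = ZeroArr D X V"
      then obtain w where "w \<in> Hom C Q V" "w \<cdot> c = g"
        using cokernel_lift[OF coker fC cC, of g V] by (auto simp: full_on_Hom_iff)
      then show "\<exists>w \<in> Hom D Q V. w \<cdot>\<^bsub>D\<^esub> c = g"
        using g c by (intro bexI[of _ w]) (auto simp: full_on_Hom_iff)
    qed
  qed
qed

lemma short_exact_full:
  assumes "i \<in> Hom D X Y" "p \<in> Hom D Y Z"
  shows "short_exact D i p \<longleftrightarrow> short_exact C i p"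
  using is_kernel_full[OF assms] is_cokernel_full[OF assms(2,1)] by (simp add: short_exact_def)

lemma brick_full: "brick D B \<longleftrightarrow> B \<in> W \<and> brick C B"
proof (cases "B \<in> W")
  case True
  then have "End_ring D B = End_ring C B" by (simp add: End_ring_def full_on_Hom)
  then show ?thesis using True wide_Obj by (simp add: brick_def)
qed (simp add: brick_def)

lemma isomorphic_full:
  assumes "X \<in> W" "Y \<in> W"
  shows "isomorphic D X Y \<longleftrightarrow> isomorphic C X Y"
  unfolding isomorphic_def full_on_Hom[OF assms]
  using iso_arrow_full[of _ X Y] unfolding full_on_Hom[OF assms] by blast

lemma iso_class_full:
  assumes X: "X \<in> W"
  shows "iso_class D X = iso_class C X"
proof (rule Set.set_eqI)
  fix Y
  show "Y \<in> iso_class D X \<longleftrightarrow> Y \<in> iso_class C X"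
  proof (cases "Y \<in> W")
    case True
    then show ?thesis using isomorphic_full[OF X True] wide_Obj[OF True] by (simp add: iso_class_def)
  next
    case False
    then show ?thesis using wide_iso[OF X] by (auto simp: iso_class_def)
  qed
qed

lemma sized_full: "sized_exact_category D size"
proof -
  interpret D: preadditive_category D by (fact preadditive_full)
  show ?thesis
  proof unfold_locales
    \<comment> \<open>A wide subcategory is only assumed nonempty; a zero object arises as the
      kernel of an identity.\<close>
    obtain X where X: "X \<in> W" using wide by (auto simp: wide_subcategory_def)
    have id: "Ident C X \<in> Hom C X X" using Ident_Hom wide_Obj X by blast
    obtain K k where k: "is_kernel C k (Ident C X)" "k \<in> Hom C K X" "monic C k"
        "Ident C X \<cdot> k = ZeroArr C K X"
      using kernel_obtain[OF id] .
    have "k = ZeroArr C K X" using k(4) Comp_Ident_left[OF k(2)] by simp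
    then have "zero_object C K" using zero_monic[OF k(3,2)] by simp
    then show "\<exists>Z. zero_object D Z" using zero_object_full wide_kernel[OF k(1,2) id X X] by blast
  next
    fix f assume "f \<in> Arr D"
    then have f: "f \<in> Hom C (Dom C f) (Cod C f)" "Dom C f \<in> W" "Cod C f \<in> W"
      by (fact full_on_Arr_Hom)+
    then have fD: "f \<in> Hom D (Dom C f) (Cod C f)" by (simp add: full_on_Hom_iff)
    obtain K k where k: "is_kernel C k f" "k \<in> Hom C K (Dom C f)" using kernel_obtain[OF f(1)] .
    have kD: "k \<in> Hom D K (Dom C f)"
      using k(2) wide_kernel[OF k f] f(2) unfolding full_on_Hom_iff by blast
    show "\<exists>k. is_kernel D k f" using k(1) unfolding is_kernel_full[OF kD fD, symmetric] by (rule exI)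
    obtain Q c where c: "is_cokernel C c f" "c \<in> Hom C (Cod C f) Q"
      using cokernel_obtain[OF f(1)] .
    have cD: "c \<in> Hom D (Cod C f) Q"
      using c(2) wide_cokernel[OF c f] f(3) unfolding full_on_Hom_iff by blast
    show "\<exists>c. is_cokernel D c f" using c(1) unfolding is_cokernel_full[OF cD fD, symmetric] by (rule exI)
  next
    fix f assume m: "monic D f"
    then have "f \<in> Arr D" by (simp add: monic_def)
    then have f: "f \<in> Hom C (Dom C f) (Cod C f)" "Dom C f \<in> W" "Cod C f \<in> W"
      by (fact full_on_Arr_Hom)+
    then have fD: "f \<in> Hom D (Dom C f) (Cod C f)" by (simp add: full_on_Hom_iff)
    then have mC: "monic C f" using m monic_full by blast
    obtain Q c where c: "short_exact C f c" "c \<in> Hom C (Cod C f) Q"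
      using short_exact_of_monic[OF mC f(1)] .
    have "Q \<in> W" using wide_cokernel[OF short_exact_HomD(5)[OF c(1) f(1) c(2)] c(2) f] .
    then have cD: "c \<in> Hom D (Cod C f) Q" using c(2) f(3) unfolding full_on_Hom_iff by blast
    have "is_kernel D f c" unfolding is_kernel_full[OF fD cD] using short_exact_HomD(4)[OF c(1) f(1) c(2)] .
    then show "\<exists>g. is_kernel D f g" by (rule exI)
  next
    fix f assume e: "epic D f"
    then have "f \<in> Arr D" by (simp add: epic_def)
    then have f: "f \<in> Hom C (Dom C f) (Cod C f)" "Dom C f \<in> W" "Cod C f \<in> W"
      by (fact full_on_Arr_Hom)+
    then have fD: "f \<in> Hom D (Dom C f) (Cod C f)" by (simp add: full_on_Hom_iff)
    then have eC: "epic C f" using e epic_full by blast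
    obtain K k where k: "short_exact C k f" "k \<in> Hom C K (Dom C f)"
      using short_exact_of_epic[OF eC f(1)] .
    have "K \<in> W" using wide_kernel[OF short_exact_HomD(4)[OF k(1,2) f(1)] k(2) f] .
    then have kD: "k \<in> Hom D K (Dom C f)" using k(2) f(2) unfolding full_on_Hom_iff by blast
    have "is_cokernel D f k"
      unfolding is_cokernel_full[OF fD kD] using short_exact_HomD(5)[OF k(1,2) f(1)] .
    then show "\<exists>g. is_cokernel D f g" by (rule exI)
  next
    fix m X Y assume "m \<in> Hom D X Y" "monic D m" "\<not> iso_arrow D m"
    then show "size X < size Y"
      using size_monic monic_full iso_arrow_full by (auto simp: full_on_Hom_iff)
  next
    fix e X Y assume "e \<in> Hom D X Y" "epic D e" "\<not> iso_arrow D e"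
    then show "size Y < size X"
      using size_epic epic_full iso_arrow_full by (auto simp: full_on_Hom_iff)
  qed
qed

end

text \<open>Every fact on torsion classes, bricks and labels is now also available for the category
  on \<open>W\<close>, with the prefix \<open>full\<close>.\<close>

sublocale wide_exact_subcategory \<subseteq> full: sized_exact_category "full_on C W" size
  by (fact sized_full)


section \<open>Lattices of torsion classes\<close>

text \<open>Unions of torsion classes need not be torsion classes, so suprema are not explicit; they
  exist as infima of upper bounds once there is a largest element and intersections stay in
  \<open>P\<close>.\<close>

lemma complete_lattice_inclusion_order:
  assumes "T \<in> P" "\<And>X. X \<in> P \<Longrightarrow> X \<subseteq> T" "\<And>F. F \<subseteq> P \<Longrightarrow> F \<noteq> {} \<Longrightarrow> \<Inter>F \<in> P"
  shows "complete_lattice (inclusion_order P)"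
proof -
  interpret partial_order "inclusion_order P"
    by unfold_locales (auto simp: inclusion_order_def)
  show ?thesis
  proof (rule complete_lattice_criterion1)
    show "\<exists>g. greatest (inclusion_order P) g (carrier (inclusion_order P))"
      using assms(1,2) by (auto simp: greatest_def inclusion_order_def)
    fix F :: "'a set set" assume "F \<subseteq> carrier (inclusion_order P)" "F \<noteq> {}"
    then have "greatest (inclusion_order P) (\<Inter>F) (Lower (inclusion_order P) F)"
      using assms(3)[of F] by (simp add: greatest_def Lower_def inclusion_order_def) blast
    then show "\<exists>i. greatest (inclusion_order P) i (Lower (inclusion_order P) F)" by blast
  qed
qed

lemma least_inclusion_order:
  assumes "F \<subseteq> P"
  shows "least (inclusion_order P) s (Upper (inclusion_order P) F) \<longleftrightarrow>
    s \<in> P \<and> (\<forall>x\<in>F. x \<subseteq> s) \<and> (\<forall>u\<in>P. (\<forall>x\<in>F. x \<subseteq> u) \<longrightarrow> s \<subseteq> u)"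
proof -
  have "Upper (inclusion_order P) F = {u \<in> P. \<forall>x\<in>F. x \<subseteq> u}"
    using assms by (simp add: Upper_def inclusion_order_def) blast
  then show ?thesis by (simp add: least_def inclusion_order_def) blast
qed

lemma greatest_inclusion_order:
  assumes "F \<subseteq> P"
  shows "greatest (inclusion_order P) s (Lower (inclusion_order P) F) \<longleftrightarrow>
    s \<in> P \<and> (\<forall>x\<in>F. s \<subseteq> x) \<and> (\<forall>l\<in>P. (\<forall>x\<in>F. l \<subseteq> x) \<longrightarrow> l \<subseteq> s)"
proof -
  have "Lower (inclusion_order P) F = {l \<in> P. \<forall>x\<in>F. l \<subseteq> x}"
    using assms by (simp add: Lower_def inclusion_order_def) blast
  then show ?thesis by (simp add: greatest_def inclusion_order_def) blast
qed

text \<open>Monotone mutually inverse maps are adjoint to each other on both sides, which is the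
  fact \<open>le\<close>. Least upper and greatest lower bounds are transported by it, and their
  uniqueness identifies them with the chosen ones.\<close>

lemma complete_lattice_isoI:
  assumes P: "complete_lattice (inclusion_order P)" and Q: "complete_lattice (inclusion_order Q)"
    and f: "\<And>x. x \<in> P \<Longrightarrow> f x \<in> Q" and g: "\<And>y. y \<in> Q \<Longrightarrow> g y \<in> P"
    and gf: "\<And>x. x \<in> P \<Longrightarrow> g (f x) = x" and fg: "\<And>y. y \<in> Q \<Longrightarrow> f (g y) = y"
    and f_mono: "\<And>x x'. x \<in> P \<Longrightarrow> x' \<in> P \<Longrightarrow> x \<subseteq> x' \<Longrightarrow> f x \<subseteq> f x'"
    and g_mono: "\<And>y y'. y \<in> Q \<Longrightarrow> y' \<in> Q \<Longrightarrow> y \<subseteq> y' \<Longrightarrow> g y \<subseteq> g y'"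
  shows "complete_lattice_iso (inclusion_order P) (inclusion_order Q) f"
proof -
  interpret P: complete_lattice "inclusion_order P" by (fact P)
  interpret Q: complete_lattice "inclusion_order Q" by (fact Q)
  have le: "f x \<subseteq> y \<longleftrightarrow> x \<subseteq> g y" "y \<subseteq> f x \<longleftrightarrow> g y \<subseteq> x" if "x \<in> P" "y \<in> Q" for x y
    using that f g gf fg f_mono g_mono by metis+
  have "bij_betw f P Q" using f g gf fg by (intro bij_betw_byWitness[where f' = g]) auto
  moreover have "f (\<Squnion>\<^bsub>inclusion_order P\<^esub> F) = \<Squnion>\<^bsub>inclusion_order Q\<^esub> (f ` F)" if F: "F \<subseteq> P" for F
  proof -
    define s where "s = \<Squnion>\<^bsub>inclusion_order P\<^esub> F"
    have fF: "f ` F \<subseteq> Q" using F f by blast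
    have "least (inclusion_order P) s (Upper (inclusion_order P) F)"
      using P.sup_lub F by (simp add: inclusion_order_def s_def)
    then have s: "s \<in> P" "\<And>x. x \<in> F \<Longrightarrow> x \<subseteq> s" "\<And>u. u \<in> P \<Longrightarrow> (\<And>x. x \<in> F \<Longrightarrow> x \<subseteq> u) \<Longrightarrow> s \<subseteq> u"
      using least_inclusion_order[OF F] by auto
    have "f s \<subseteq> u" if "u \<in> Q" "\<forall>y\<in>f ` F. y \<subseteq> u" for u
    proof -
      have "s \<subseteq> g u"
      proof (rule s(3)[OF g[OF that(1)]])
        fix x assume "x \<in> F"
        then have "x \<in> P" "f x \<subseteq> u" using F that(2) by auto
        then show "x \<subseteq> g u" using le(1) that(1) by simp
      qed
      then show ?thesis using le(1) s(1) that(1) by simp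
    qed
    moreover have "y \<subseteq> f s" if "y \<in> f ` F" for y
      using that f_mono[OF _ s(1) s(2)] F by (elim imageE) (simp add: subset_iff[of F])
    ultimately have "least (inclusion_order Q) (f s) (Upper (inclusion_order Q) (f ` F))"
      unfolding least_inclusion_order[OF fF] using f[OF s(1)] by (intro conjI ballI impI) simp_all
    moreover have "least (inclusion_order Q) (\<Squnion>\<^bsub>inclusion_order Q\<^esub> (f ` F))
        (Upper (inclusion_order Q) (f ` F))"
      using Q.sup_lub fF by (simp add: inclusion_order_def)
    ultimately show ?thesis unfolding s_def by (rule Q.least_unique)
  qed
  moreover have "f (\<Sqinter>\<^bsub>inclusion_order P\<^esub> F) = \<Sqinter>\<^bsub>inclusion_order Q\<^esub> (f ` F)" if F: "F \<subseteq> P" for F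
  proof -
    define s where "s = \<Sqinter>\<^bsub>inclusion_order P\<^esub> F"
    have fF: "f ` F \<subseteq> Q" using F f by blast
    have "greatest (inclusion_order P) s (Lower (inclusion_order P) F)"
      using P.inf_glb F by (simp add: inclusion_order_def s_def)
    then have s: "s \<in> P" "\<And>x. x \<in> F \<Longrightarrow> s \<subseteq> x" "\<And>l. l \<in> P \<Longrightarrow> (\<And>x. x \<in> F \<Longrightarrow> l \<subseteq> x) \<Longrightarrow> l \<subseteq> s"
      using greatest_inclusion_order[OF F] by auto
    have "l \<subseteq> f s" if "l \<in> Q" "\<forall>y\<in>f ` F. l \<subseteq> y" for l
    proof -
      have "g l \<subseteq> s"
      proof (rule s(3)[OF g[OF that(1)]])
        fix x assume "x \<in> F"
        then have "x \<in> P" "l \<subseteq> f x" using F that(2) by auto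
        then show "g l \<subseteq> x" using le(2) that(1) by simp
      qed
      then show ?thesis using le(2) s(1) that(1) by simp
    qed
    moreover have "f s \<subseteq> y" if "y \<in> f ` F" for y
      using that f_mono[OF s(1) _ s(2)] F by (elim imageE) (simp add: subset_iff[of F])
    ultimately have "greatest (inclusion_order Q) (f s) (Lower (inclusion_order Q) (f ` F))"
      unfolding greatest_inclusion_order[OF fF] using f[OF s(1)] by (intro conjI ballI impI) simp_all
    moreover have "greatest (inclusion_order Q) (\<Sqinter>\<^bsub>inclusion_order Q\<^esub> (f ` F))
        (Lower (inclusion_order Q) (f ` F))"
      using Q.inf_glb fF by (simp add: inclusion_order_def)
    ultimately show ?thesis unfolding s_def by (rule Q.greatest_unique)
  qed
  ultimately show ?thesis
    using P Q by (simp add: complete_lattice_iso_def sup_pres_def inf_pres_def inclusion_order_def)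
qed

section \<open>Hasse arrows under order isomorphisms and in intervals\<close>

lemma hasse_arrow_iso:
  assumes f: "\<And>x. x \<in> P \<Longrightarrow> f x \<in> Q" and g: "\<And>y. y \<in> Q \<Longrightarrow> g y \<in> P"
    and fg: "\<And>y. y \<in> Q \<Longrightarrow> f (g y) = y"
    and less: "\<And>x x'. x \<in> P \<Longrightarrow> x' \<in> P \<Longrightarrow> f x < f x' \<longleftrightarrow> x < x'"
    and xy: "x \<in> P" "y \<in> P"
  shows "hasse_arrow Q (f x) (f y) \<longleftrightarrow> hasse_arrow P x y"
proof -
  have "(\<exists>z\<in>Q. f y < z \<and> z < f x) \<longleftrightarrow> (\<exists>z\<in>P. y < z \<and> z < x)"
  proof
    assume "\<exists>z\<in>Q. f y < z \<and> z < f x"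
    then obtain z where z: "z \<in> Q" "f y < z" "z < f x" by blast
    then show "\<exists>z\<in>P. y < z \<and> z < x"
      using g[OF z(1)] fg[OF z(1)] less[OF xy(2) g[OF z(1)]] less[OF g[OF z(1)] xy(1)]
      by (intro bexI[of _ "g z"]) auto
  next
    assume "\<exists>z\<in>P. y < z \<and> z < x"
    then show "\<exists>z\<in>Q. f y < z \<and> z < f x" using f less xy by blast
  qed
  then show ?thesis using f less xy by (auto simp: hasse_arrow_def)
qed

text \<open>An interval is convex: a torsion class strictly between two of its members belongs to
  it.\<close>

lemma hasse_arrow_interval:
  assumes "V1 \<in> tors_interval C U T" "V2 \<in> tors_interval C U T"
  shows "hasse_arrow (tors_interval C U T) V1 V2 \<longleftrightarrow> hasse_arrow (tors C) V1 V2"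
proof -
  have V: "V1 \<in> tors C" "V2 \<in> tors C" "U \<subseteq> V2" "V1 \<subseteq> T"
    using assms by (simp_all add: tors_interval_def)
  have "Z \<in> tors_interval C U T" if "Z \<in> tors C" "V2 \<subset> Z" "Z \<subset> V1" for Z
    using that(1) order_trans[OF V(3) psubset_imp_subset[OF that(2)]]
      order_trans[OF psubset_imp_subset[OF that(3)] V(4)] by (simp add: tors_interval_def)
  moreover have "Z \<in> tors C" if "Z \<in> tors_interval C U T" for Z
    using that by (simp add: tors_interval_def)
  ultimately show ?thesis using assms V(1,2) unfolding hasse_arrow_def by metis
qed


section \<open>Wide intervals\<close>

locale wide_torsion_interval = sized_exact_category C size
  for C :: "('o, 'm, 'z) additive_cat_scheme" (structure) and size +
  fixes U T :: "'o set"
  assumes wide_interval: "wide_interval C U T"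
begin

definition W where "W = right_perp C U \<inter> T"

lemma U_tors: "U \<in> tors C" and T_tors: "T \<in> tors C" and U_T: "U \<subseteq> T"
  and W_wide: "wide_subcategory C W"
  using wide_interval by (auto simp: wide_interval_def W_def)

lemma U_Obj: "U \<subseteq> Obj C"
  using tors_Obj[OF U_tors] by blast

lemma wide_subcategory: "wide_exact_subcategory C size W"
  using sized_exact_category_axioms W_wide
  by (intro wide_exact_subcategory.intro wide_exact_subcategory_axioms.intro)

end

sublocale wide_torsion_interval \<subseteq> wide_exact_subcategory C size W
  by (fact wide_subcategory)

context wide_torsion_interval
begin

definition \<Phi> where "\<Phi> V = right_perp C U \<inter> V"

text \<open>
  Described by quotients instead of by the torsion submodule, \<open>U * X\<close> is visibly closed under factor
  objects.
\<close>

definition \<Psi> where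
  "\<Psi> X = {M \<in> T. \<forall>N. \<forall>e \<in> Hom C M N. epic C e \<longrightarrow> N \<in> right_perp C U \<longrightarrow> N \<in> X}"

abbreviation (input) I where "I \<equiv> tors_interval C U T"

lemma intervalD:
  assumes "V \<in> I"
  shows "V \<in> tors C" "U \<subseteq> V" "V \<subseteq> T"
  using assms by (auto simp: tors_interval_def)

lemma U_T_in_interval: "U \<in> I" "T \<in> I"
  using U_tors T_tors U_T by (auto simp: tors_interval_def)

lemma Phi_subset_W: "V \<in> I \<Longrightarrow> \<Phi> V \<subseteq> W"
  by (auto simp: \<Phi>_def W_def dest: intervalD(3))

lemma Phi_mem: "V \<in> I \<Longrightarrow> X \<in> \<Phi> V \<longleftrightarrow> X \<in> W \<and> X \<in> V"
  using intervalD(3) by (auto simp: \<Phi>_def W_def)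

section \<open>The two maps are well defined and mutually inverse\<close>

lemma Phi_tors:
  assumes V: "V \<in> I"
  shows "\<Phi> V \<in> tors D"
proof (rule full.torsI)
  note VT = intervalD(1)[OF V]
  show "\<Phi> V \<subseteq> Obj D" using Phi_subset_W[OF V] by simp
  obtain Z where Z: "zero_object C Z" using zero_object_ex by blast
  then have "Z \<in> \<Phi> V" using right_perp_zero[OF U_Obj] tors_zero[OF VT] by (simp add: \<Phi>_def)
  then show "\<Phi> V \<noteq> {}" by blast
next
  fix X Y e assume X: "X \<in> \<Phi> V" and e: "e \<in> Hom D X Y" "epic D e"
  have "e \<in> Hom C X Y" "Y \<in> W" using e(1) by (auto simp: full_on_Hom_iff)
  then show "Y \<in> \<Phi> V"
    using tors_factor[OF intervalD(1)[OF V]] X e(2) epic_full[OF e(1)] Phi_mem[OF V] by blast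
next
  fix A B Q i p
  assume ex: "short_exact D i p" and i: "i \<in> Hom D A B" and p: "p \<in> Hom D B Q"
    and A: "A \<in> \<Phi> V" and Q: "Q \<in> \<Phi> V"
  have "i \<in> Hom C A B" "p \<in> Hom C B Q" "B \<in> W" using i p by (auto simp: full_on_Hom_iff)
  then show "B \<in> \<Phi> V"
    using tors_ext[OF intervalD(1)[OF V]] ex A Q short_exact_full[OF i p] Phi_mem[OF V] by blast
qed

text \<open>The closure properties of \<open>X\<close> in \<open>D\<close> are restated with epics
  and short exact sequences of the ambient category. For extensions, wideness first places the
  middle term in \<open>W\<close>.\<close>

lemma full_torsD:
  assumes X: "X \<in> tors D"
  shows "X \<subseteq> W" "zero_object C Z \<Longrightarrow> Z \<in> X"
    "\<lbrakk>M \<in> X; e \<in> Hom C M N; epic C e; N \<in> W\<rbrakk> \<Longrightarrow> N \<in> X"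
    "\<lbrakk>short_exact C i p; i \<in> Hom C A B; p \<in> Hom C B Q; A \<in> X; Q \<in> X\<rbrakk> \<Longrightarrow> B \<in> X"
proof -
  show XW: "X \<subseteq> W" using full.tors_Obj[OF X] by auto
  show "Z \<in> X" if "zero_object C Z"
  proof -
    have "Z \<in> W"
      unfolding W_def using right_perp_zero[OF U_Obj that] tors_zero[OF T_tors that] by blast
    then show ?thesis using full.tors_zero[OF X] zero_object_full that by blast
  qed
  show "N \<in> X" if "M \<in> X" "e \<in> Hom C M N" "epic C e" "N \<in> W"
  proof -
    have e: "e \<in> Hom D M N" using that XW unfolding full_on_Hom_iff by blast
    show ?thesis using full.tors_factor[OF X that(1) e] that(3) epic_full[OF e] by blast
  qed
  show "B \<in> X" if "short_exact C i p" "i \<in> Hom C A B" "p \<in> Hom C B Q" "A \<in> X" "Q \<in> X"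
  proof -
    have "B \<in> W" using wide_ext[OF that(1-3)] that(4,5) XW by blast
    then have ip: "i \<in> Hom D A B" "p \<in> Hom D B Q"
      using that XW unfolding full_on_Hom_iff by blast+
    show ?thesis using full.tors_ext[OF X _ ip that(4,5)] that(1) short_exact_full[OF ip] by blast
  qed
qed

lemma Psi_in_interval:
  assumes X: "X \<in> tors D"
  shows "\<Psi> X \<in> I"
proof -
  note X = full_torsD[OF X]
  have U: "U \<subseteq> \<Psi> X"
  proof
    fix M assume M: "M \<in> U"
    have "N \<in> X" if "e \<in> Hom C M N" "epic C e" "N \<in> right_perp C U" for N e
      using X(2) right_perp_meet_zero[OF U_Obj _ that(3)] tors_factor[OF U_tors M that(1,2)] by blast
    then show "M \<in> \<Psi> X" using M U_T unfolding \<Psi>_def by blast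
  qed
  have "\<Psi> X \<in> tors C"
  proof (rule torsI)
    show "\<Psi> X \<subseteq> Obj C" using tors_Obj[OF T_tors] by (auto simp: \<Psi>_def)
    show "\<Psi> X \<noteq> {}" using U tors_zero[OF U_tors] zero_object_ex by blast
  next
    fix M M' e assume M: "M \<in> \<Psi> X" and e: "e \<in> Hom C M M'" "epic C e"
    have "N \<in> X" if "d \<in> Hom C M' N" "epic C d" "N \<in> right_perp C U" for N d
      using M Comp_Hom[OF e(1) that(1)] epic_comp[OF e(2) that(2) e(1) that(1)] that(3)
      unfolding \<Psi>_def by blast
    moreover have "M' \<in> T" using M tors_factor[OF T_tors _ e] by (simp add: \<Psi>_def)
    ultimately show "M' \<in> \<Psi> X" unfolding \<Psi>_def by blast
  next
    fix L M N i p
    assume ex: "short_exact C i p" and i: "i \<in> Hom C L M" and p: "p \<in> Hom C M N"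
      and L: "L \<in> \<Psi> X" and N: "N \<in> \<Psi> X"
    have LT: "L \<in> T" and "N \<in> T" using L N by (auto simp: \<Psi>_def)
    then have M: "M \<in> T" using tors_ext[OF T_tors ex i p] by blast
    have "Q \<in> X" if e: "e \<in> Hom C M Q" "epic C e" and Q: "Q \<in> right_perp C U" for Q e
    proof -
      obtain J R a b c r where q: "a \<in> Hom C L J" "epic C a" "b \<in> Hom C J Q" "c \<in> Hom C Q R"
          "short_exact C b c" "r \<in> Hom C N R" "epic C r"
        using extension_quotient[OF ex i p e] .
      note bc = short_exact_HomD[OF q(5,3,4)]
      have QW: "Q \<in> W" using tors_factor[OF T_tors M e] Q by (simp add: W_def)
      have J: "J \<in> right_perp C U" using right_perp_sub[OF U_Obj Q q(3) bc(1)] .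
      then have JX: "J \<in> X" using L q(1,2) unfolding \<Psi>_def by blast
      \<comment> \<open>Closure of \<open>W\<close> under cokernels is decisive here: it gives that
        \<open>R\<close> is torsion-free for \<open>U\<close>, so that the condition on the
        quotients of \<open>N\<close> applies to it.\<close>
      have "R \<in> W" using wide_cokernel[OF bc(5) q(4,3)] QW JX X(1) by blast
      then have "R \<in> X" using N q(6,7) unfolding \<Psi>_def W_def by blast
      then show ?thesis using X(4)[OF q(5,3,4) JX] by blast
    qed
    then show "M \<in> \<Psi> X" using M unfolding \<Psi>_def by blast
  qed
  then show ?thesis using U by (auto simp: tors_interval_def \<Psi>_def)
qed

lemma subset_Psi:
  assumes X: "X \<in> tors D"
  shows "X \<subseteq> \<Psi> X"
proof
  fix M assume M: "M \<in> X"
  then have MT: "M \<in> T" using full_torsD(1)[OF X] by (auto simp: W_def)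
  have "N \<in> X" if "e \<in> Hom C M N" "epic C e" "N \<in> right_perp C U" for N e
    using full_torsD(3)[OF X M that(1,2)] tors_factor[OF T_tors MT that(1,2)] that(3)
    unfolding W_def by blast
  then show "M \<in> \<Psi> X" using MT unfolding \<Psi>_def by blast
qed

lemma Phi_Psi:
  assumes X: "X \<in> tors D"
  shows "\<Phi> (\<Psi> X) = X"
proof
  show "X \<subseteq> \<Phi> (\<Psi> X)"
    using subset_Psi[OF X] full_torsD(1)[OF X] by (auto simp: \<Phi>_def W_def)
  show "\<Phi> (\<Psi> X) \<subseteq> X"
  proof
    fix M assume M: "M \<in> \<Phi> (\<Psi> X)"
    then have MO: "M \<in> Obj C" using tors_Obj[OF T_tors] by (auto simp: \<Phi>_def \<Psi>_def)
    show "M \<in> X"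
      using M Ident_Hom[OF MO] iso_arrow_epic[OF iso_arrow_Ident[OF MO]] unfolding \<Phi>_def \<Psi>_def
      by blast
  qed
qed

text \<open>The torsion-free quotient of an object of \<open>\<Psi> X\<close> lies in
  \<open>X\<close> by definition of \<open>\<Psi>\<close>. The other inclusion holds because
  \<open>\<Psi> X\<close> is a torsion class containing both \<open>U\<close> and
  \<open>X\<close>.\<close>

lemma Psi_eq_ext_product:
  assumes X: "X \<in> tors D"
  shows "\<Psi> X = ext_product C U X"
proof
  show "\<Psi> X \<subseteq> ext_product C U X"
  proof
    fix M assume M: "M \<in> \<Psi> X"
    then have MO: "M \<in> Obj C" using tors_Obj[OF T_tors] by (auto simp: \<Psi>_def)
    obtain A N i p where d: "short_exact C i p" "i \<in> Hom C A M" "p \<in> Hom C M N" "A \<in> U"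
        "N \<in> right_perp C U"
      using torsion_decomposition[OF U_tors MO] .
    have "N \<in> X" using M d(3,5) short_exact_HomD(2)[OF d(1-3)] unfolding \<Psi>_def by blast
    then show "M \<in> ext_product C U X"
      using MO d(1,4) HomD[OF d(2)] HomD[OF d(3)] unfolding ext_product_def by blast
  qed
  show "ext_product C U X \<subseteq> \<Psi> X"
  proof
    fix M assume "M \<in> ext_product C U X"
    then obtain f g where fg: "short_exact C f g" "Dom C f \<in> U" "Cod C f = M" "Cod C g \<in> X"
      unfolding ext_product_def by blast
    then show "M \<in> \<Psi> X"
      using tors_ext[OF intervalD(1)[OF Psi_in_interval[OF X]] fg(1) short_exactD(1,2)[OF fg(1)]]
        intervalD(2)[OF Psi_in_interval[OF X]] subset_Psi[OF X] by blast
  qed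
qed

lemma Psi_least:
  assumes X: "X \<in> tors D" and V: "V \<in> tors C" "U \<union> X \<subseteq> V"
  shows "\<Psi> X \<subseteq> V"
proof
  fix M assume "M \<in> \<Psi> X"
  then obtain f g where fg: "short_exact C f g" "Dom C f \<in> U" "Cod C f = M" "Cod C g \<in> X"
    unfolding Psi_eq_ext_product[OF X] ext_product_def by blast
  then show "M \<in> V" using tors_ext[OF V(1) fg(1) short_exactD(1,2)[OF fg(1)]] V(2) by blast
qed

lemma Psi_eq_gen_tors:
  assumes X: "X \<in> tors D"
  shows "gen_tors C (U \<union> X) = \<Psi> X"
  unfolding gen_tors_def
proof (rule Least_equality)
  show "\<Psi> X \<in> tors C \<and> U \<union> X \<subseteq> \<Psi> X"
    using intervalD[OF Psi_in_interval[OF X]] subset_Psi[OF X] by blast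
qed (use Psi_least[OF X] in blast)

lemma Psi_Phi:
  assumes V: "V \<in> I"
  shows "\<Psi> (\<Phi> V) = V"
proof
  note VV = intervalD[OF V]
  show "\<Psi> (\<Phi> V) \<subseteq> V" using Psi_least[OF Phi_tors[OF V] VV(1)] VV(2) by (auto simp: \<Phi>_def)
  show "V \<subseteq> \<Psi> (\<Phi> V)"
    using VV(3) tors_factor[OF VV(1)] unfolding \<Psi>_def \<Phi>_def by blast
qed

lemma Phi_mono: "V \<subseteq> V' \<Longrightarrow> \<Phi> V \<subseteq> \<Phi> V'"
  by (auto simp: \<Phi>_def)

lemma Psi_mono: "X \<subseteq> X' \<Longrightarrow> \<Psi> X \<subseteq> \<Psi> X'"
  by (auto simp: \<Psi>_def)

section \<open>The lattice isomorphism, Hasse arrows and labels\<close>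

lemma complete_lattice_interval: "complete_lattice (inclusion_order I)"
proof (rule complete_lattice_inclusion_order[OF U_T_in_interval(2)])
  show "V \<subseteq> T" if "V \<in> I" for V using intervalD(3)[OF that] .
  show "\<Inter>F \<in> I" if F: "F \<subseteq> I" "F \<noteq> {}" for F
  proof -
    have "\<Inter>F \<in> tors C" using tors_Inter[of F] F intervalD(1) by blast
    moreover have "U \<subseteq> \<Inter>F" using F intervalD(2) by blast
    moreover have "\<Inter>F \<subseteq> T" using F intervalD(3) by blast
    ultimately show ?thesis by (simp add: tors_interval_def)
  qed
qed

lemma complete_lattice_full: "complete_lattice (inclusion_order (tors D))"
  using full.tors_Obj_mem full.tors_Obj full.tors_Inter
  by (intro complete_lattice_inclusion_order[of "Obj D"]) blast+

lemma Phi_iso: "complete_lattice_iso (inclusion_order I) (inclusion_order (tors D)) \<Phi>"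
  by (rule complete_lattice_isoI[OF complete_lattice_interval complete_lattice_full,
        where g = \<Psi>]) (simp_all add: Phi_tors Psi_in_interval Psi_Phi Phi_Psi Phi_mono Psi_mono)

lemma hasse_arrow_Phi:
  assumes V: "V1 \<in> I" "V2 \<in> I"
  shows "hasse_arrow (tors D) (\<Phi> V1) (\<Phi> V2) \<longleftrightarrow> hasse_arrow I V1 V2"
proof (rule hasse_arrow_iso[where g = \<Psi>])
  show "\<Phi> x < \<Phi> x' \<longleftrightarrow> x < x'" if "x \<in> I" "x' \<in> I" for x x'
    unfolding less_le using Phi_mono Psi_mono[of "\<Phi> x" "\<Phi> x'"] Psi_Phi that by metis
qed (simp_all add: Phi_tors Psi_in_interval Phi_Psi V)

text \<open>
  Since \<open>V2 = U * \<Phi> V2\<close>, an object of \<open>U\<^sup>\<bottom>\<close> receives no nonzero arrows from \<open>V2\<close> as soon as it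
  receives none from \<open>\<Phi> V2\<close>.
\<close>

lemma right_perp_full:
  assumes V: "V1 \<in> I" "V2 \<in> I"
  shows "right_perp D (\<Phi> V2) \<inter> \<Phi> V1 = right_perp C V2 \<inter> V1"
proof (rule Set.set_eqI)
  fix Y
  note V1 = intervalD[OF V(1)] and V2 = intervalD[OF V(2)]
  have V2O: "V2 \<subseteq> Obj C" using tors_Obj[OF V2(1)] by blast
  have Phi2: "\<Phi> V2 \<subseteq> Obj D" using Phi_subset_W[OF V(2)] by simp
  show "Y \<in> right_perp D (\<Phi> V2) \<inter> \<Phi> V1 \<longleftrightarrow> Y \<in> right_perp C V2 \<inter> V1"
  proof
    assume Y: "Y \<in> right_perp D (\<Phi> V2) \<inter> \<Phi> V1"
    then have YW: "Y \<in> W" "Y \<in> V1" using Phi_mem[OF V(1)] by auto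
    have YU: "Y \<in> right_perp C U" using YW by (simp add: W_def)
    have "f = ZeroArr C M Y" if M: "M \<in> V2" and f: "f \<in> Hom C M Y" for M f
    proof -
      have MO: "M \<in> Obj C" using M V2O by blast
      obtain A N i p where d: "short_exact C i p" "i \<in> Hom C A M" "p \<in> Hom C M N" "A \<in> U"
          "N \<in> right_perp C U"
        using torsion_decomposition[OF U_tors MO] .
      note ip = short_exact_HomD[OF d(1-3)]
      have "N \<in> V2" using tors_factor[OF V2(1) M d(3) ip(2)] .
      then have N: "N \<in> \<Phi> V2" using d(5) by (simp add: \<Phi>_def)
      have "f \<cdot> i = ZeroArr C A Y" using YU right_perp_iff[OF U_Obj] d(4) Comp_Hom[OF d(2) f] by blast
      then obtain u where u: "u \<in> Hom C N Y" "u \<cdot> p = f"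
        using cokernel_lift[OF ip(5) d(2,3) f] by blast
      have "u \<in> Hom D N Y" using u(1) N YW Phi_mem[OF V(2)] unfolding full_on_Hom_iff by blast
      then have "u = ZeroArr C N Y" using Y N full.right_perp_iff[OF Phi2] by simp
      then show ?thesis using u(2) comp_zero_left[OF d(3)] Hom_Obj[OF f] by simp
    qed
    then show "Y \<in> right_perp C V2 \<inter> V1"
      using right_perp_iff[OF V2O] YW wide_Obj by blast
  next
    assume Y: "Y \<in> right_perp C V2 \<inter> V1"
    then have "Y \<in> right_perp C U" using V2(2) by (auto simp: right_perp_def)
    then have YP: "Y \<in> \<Phi> V1" using Y by (simp add: \<Phi>_def)
    then have YW: "Y \<in> W" using Phi_subset_W[OF V(1)] by blast
    have "f = ZeroArr D M Y" if "M \<in> \<Phi> V2" "f \<in> Hom D M Y" for M f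
      using Y that Phi_mem[OF V(2)] right_perp_iff[OF V2O] by (simp add: full_on_Hom_iff)
    then show "Y \<in> right_perp D (\<Phi> V2) \<inter> \<Phi> V1"
      using full.right_perp_iff[OF Phi2] YP YW by auto
  qed
qed

text \<open>Both labels are read off the same class of objects. Endomorphism rings do not change in
  a full subcategory, and isomorphism classes do not change because \<open>W\<close> is closed under
  isomorphism.\<close>

lemma brick_label_Phi:
  assumes V: "V1 \<in> I" "V2 \<in> I"
  shows "brick_label D (\<Phi> V1) (\<Phi> V2) L \<longleftrightarrow> brick_label C V1 V2 L"
proof -
  have "{B \<in> right_perp D (\<Phi> V2) \<inter> \<Phi> V1. brick D B} = {B \<in> right_perp C V2 \<inter> V1. brick C B}"
    (is "?K = ?H")
    using right_perp_full[OF V] brick_full Phi_subset_W[OF V(1)] by blast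
  moreover have "?H \<subseteq> W" using right_perp_full[OF V] Phi_subset_W[OF V(1)] by blast
  then have "iso_class D ` ?H = iso_class C ` ?H" using iso_class_full by (intro image_cong) auto
  ultimately show ?thesis
    unfolding brick_label_def using hasse_arrow_Phi[OF V] hasse_arrow_interval[OF V] by simp
qed

text \<open>\<open>\<Phi>\<close> sends \<open>T\<close> to the largest torsion class of
  \<open>W\<close>. Being onto and compatible with labels, it turns the statement about the full
  lattice of \<open>W\<close> into one about the interval.\<close>

lemma sim_eq_labels_from_top:
  "sim D = {L. \<exists>V. hasse_arrow I T V \<and> brick_label C T V L}"
proof -
  have "Obj D = \<Phi> T" by (simp add: W_def \<Phi>_def)
  have "(\<exists>X. brick_label D (Obj D) X L) \<longleftrightarrow> (\<exists>V. hasse_arrow I T V \<and> brick_label C T V L)" for L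
  proof
    assume "\<exists>X. brick_label D (Obj D) X L"
    then obtain X where X: "brick_label D (\<Phi> T) X L" using \<open>Obj D = \<Phi> T\<close> by auto
    then have "X \<in> tors D" by (simp add: brick_label_def hasse_arrow_def)
    then have "\<Psi> X \<in> I" "\<Phi> (\<Psi> X) = X" using Psi_in_interval Phi_Psi by auto
    then show "\<exists>V. hasse_arrow I T V \<and> brick_label C T V L"
      using X brick_label_Phi[OF U_T_in_interval(2)] hasse_arrow_interval[OF U_T_in_interval(2)]
      by (metis brick_label_def)
  next
    assume "\<exists>V. hasse_arrow I T V \<and> brick_label C T V L"
    then show "\<exists>X. brick_label D (Obj D) X L"
      unfolding \<open>Obj D = \<Phi> T\<close> using brick_label_Phi[OF U_T_in_interval(2)]
      by (metis hasse_arrow_def)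
  qed
  then show ?thesis using full.sim_eq_labels_from_top by simp
qed

lemma sim_eq_labels_to_bottom:
  "sim D = {L. \<exists>V. hasse_arrow I V U \<and> brick_label C V U L}"
proof -
  \<comment> \<open>An object of \<open>U\<close> that is torsion-free for \<open>U\<close> has zero
    identity, so \<open>U\<close> corresponds to the smallest torsion class of
    \<open>W\<close>.\<close>
  have bot: "{Z. zero_object D Z} = \<Phi> U"
  proof (rule Set.set_eqI)
    fix Z
    show "Z \<in> {Z. zero_object D Z} \<longleftrightarrow> Z \<in> \<Phi> U"
      using zero_object_full[of Z] right_perp_meet_zero[OF U_Obj] tors_zero[OF U_tors]
        Phi_mem[OF U_T_in_interval(1)] unfolding W_def by blast
  qed
  have "(\<exists>X. brick_label D X (\<Phi> U) L) \<longleftrightarrow> (\<exists>V. hasse_arrow I V U \<and> brick_label C V U L)" for L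
  proof
    assume "\<exists>X. brick_label D X (\<Phi> U) L"
    then obtain X where X: "brick_label D X (\<Phi> U) L" by auto
    then have "X \<in> tors D" by (simp add: brick_label_def hasse_arrow_def)
    then have "\<Psi> X \<in> I" "\<Phi> (\<Psi> X) = X" using Psi_in_interval Phi_Psi by auto
    then show "\<exists>V. hasse_arrow I V U \<and> brick_label C V U L"
      using X brick_label_Phi[OF _ U_T_in_interval(1)] hasse_arrow_interval[OF _ U_T_in_interval(1)]
      by (metis brick_label_def)
  next
    assume "\<exists>V. hasse_arrow I V U \<and> brick_label C V U L"
    then show "\<exists>X. brick_label D X (\<Phi> U) L"
      using brick_label_Phi[OF _ U_T_in_interval(1)] by (metis hasse_arrow_def)
  qed
  then show ?thesis using full.sim_eq_labels_to_bottom bot by simp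
qed

end


theorem theorem1p4:
  fixes A :: "('o, 'm, 'z) additive_cat_scheme"
    and U T W :: "'o set"
    and \<W> :: "('o, 'm, 'z) additive_cat_scheme"
    and \<Phi> \<Psi> :: "'o set \<Rightarrow> 'o set"
  assumes "abelian_length_category A"
    and "wide_interval A U T"
    and W: "W = right_perp A U \<inter> T"
    and cat_W: "\<W> = full_on A W"
    and Phi: "\<Phi> = (\<lambda>V. right_perp A U \<inter> V)"
    and Psi: "\<Psi> = (\<lambda>X. gen_tors A (U \<union> X))"
  shows "(complete_lattice_iso (inclusion_order (tors_interval A U T)) (inclusion_order (tors \<W>)) \<Phi>
        \<and> complete_lattice_iso (inclusion_order (tors \<W>)) (inclusion_order (tors_interval A U T)) \<Psi>
        \<and> (\<forall>V \<in> tors_interval A U T. \<Psi> (\<Phi> V) = V)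
        \<and> (\<forall>X \<in> tors \<W>. \<Phi> (\<Psi> X) = X)
        \<and> (\<forall>X \<in> tors \<W>. \<Psi> X = ext_product A U X))
    \<and> (\<forall>V1 V2. hasse_arrow (tors_interval A U T) V1 V2 \<longrightarrow>
          hasse_arrow (tors \<W>) (\<Phi> V1) (\<Phi> V2)
        \<and> (\<exists>L. brick_label A V1 V2 L \<and> brick_label \<W> (\<Phi> V1) (\<Phi> V2) L))
    \<and> (sim \<W> = {L. \<exists>V. hasse_arrow (tors_interval A U T) T V \<and> brick_label A T V L}
        \<and> sim \<W> = {L. \<exists>V. hasse_arrow (tors_interval A U T) V U \<and> brick_label A V U L})"
proof -
  interpret abelian_length_category A by fact
  interpret preadditive_exact_category A by (fact preadditive_exact)
  interpret sized_exact_category A "\<lambda>X. LEAST n. series n X"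
    by (rule finite_length_sized) (fact finite_length)
  interpret I: wide_torsion_interval A "\<lambda>X. LEAST n. series n X" U T
    using sized_exact_category_axioms assms(2)
    by (intro wide_torsion_interval.intro wide_torsion_interval_axioms.intro)
  have W_eq: "\<W> = full_on A I.W" by (simp add: cat_W W I.W_def)
  have Phi_eq: "\<Phi> = I.\<Phi>" by (simp add: Phi I.\<Phi>_def fun_eq_iff)
  \<comment> \<open>The generated torsion class and the quotient description are identified only on
    torsion classes of \<open>W\<close>, not as functions. For this reason the isomorphism property
    of \<open>\<Psi>\<close> is derived on its carrier, after that of \<open>\<Phi>\<close>.\<close>
  have Psi_eq: "\<Psi> X = I.\<Psi> X" if "X \<in> tors \<W>" for X
    using I.Psi_eq_gen_tors that by (simp add: Psi W_eq)
  have Phi_iso: "complete_lattice_iso (inclusion_order (tors_interval A U T))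
      (inclusion_order (tors \<W>)) \<Phi>"
    unfolding Phi_eq W_eq by (fact I.Phi_iso)
  have Psi_Phi: "\<Psi> (\<Phi> V) = V" if "V \<in> tors_interval A U T" for V
    using Psi_eq[of "\<Phi> V"] I.Phi_tors[OF that] I.Psi_Phi[OF that] by (simp add: Phi_eq W_eq)
  have Phi_Psi: "\<Phi> (\<Psi> X) = X" if "X \<in> tors \<W>" for X
    using Psi_eq[OF that] I.Phi_Psi that by (simp add: Phi_eq W_eq)
  have "complete_lattice_iso (inclusion_order (tors \<W>)) (inclusion_order (tors_interval A U T)) \<Psi>"
  proof (rule complete_lattice_isoI[where g = \<Phi>])
    show "complete_lattice (inclusion_order (tors \<W>))"
      unfolding W_eq by (fact I.complete_lattice_full)
    show "complete_lattice (inclusion_order (tors_interval A U T))"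
      by (fact I.complete_lattice_interval)
    show "\<Psi> X \<in> tors_interval A U T" if "X \<in> tors \<W>" for X
      using Psi_eq[OF that] I.Psi_in_interval that by (simp add: W_eq)
    show "\<Phi> V \<in> tors \<W>" if "V \<in> tors_interval A U T" for V
      using I.Phi_tors[OF that] by (simp add: Phi_eq W_eq)
    show "\<Psi> X \<subseteq> \<Psi> X'" if "X \<in> tors \<W>" "X' \<in> tors \<W>" "X \<subseteq> X'" for X X'
      using Psi_eq that I.Psi_mono by simp
    show "\<Phi> V \<subseteq> \<Phi> V'" if "V \<subseteq> V'" for V V'
      using I.Phi_mono[OF that] by (simp add: Phi_eq)
  qed (simp_all add: Psi_Phi Phi_Psi)
  moreover have "\<Psi> X = ext_product A U X" if "X \<in> tors \<W>" for X
    using Psi_eq[OF that] I.Psi_eq_ext_product that by (simp add: W_eq)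
  moreover have "hasse_arrow (tors \<W>) (\<Phi> V1) (\<Phi> V2)
        \<and> (\<exists>L. brick_label A V1 V2 L \<and> brick_label \<W> (\<Phi> V1) (\<Phi> V2) L)"
    if h: "hasse_arrow (tors_interval A U T) V1 V2" for V1 V2
  proof -
    have V: "V1 \<in> tors_interval A U T" "V2 \<in> tors_interval A U T"
      using h by (auto simp: hasse_arrow_def)
    obtain L where "brick_label A V1 V2 L"
      using hasse_arrow_brick_label h hasse_arrow_interval[OF V] by blast
    then show ?thesis
      using I.hasse_arrow_Phi[OF V] I.brick_label_Phi[OF V] h unfolding Phi_eq W_eq by blast
  qed
  moreover have "sim \<W> = {L. \<exists>V. hasse_arrow (tors_interval A U T) T V \<and> brick_label A T V L}"
    unfolding W_eq by (fact I.sim_eq_labels_from_top)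
  moreover have "sim \<W> = {L. \<exists>V. hasse_arrow (tors_interval A U T) V U \<and> brick_label A V U L}"
    unfolding W_eq by (fact I.sim_eq_labels_to_bottom)
  ultimately show ?thesis using Phi_iso Psi_Phi Phi_Psi by blast
qed

end
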